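(* Let $d\ge1$ be an integer and let $q>1$. Then $$\sup\Big\{F_q(\Omega)\ :\ \Omega\text{ open in }\mathbb{R}^d,\ 0<|\Omega|<\infty\Big\}\le\Big(\frac{1}{d(d+2)\,\omega_d^{2/d}}\Big)^{q-1}.$$
   Context: $\omega_d$ is the Lebesgue measure of the unit ball of $\mathbb{R}^d$. For an open set $\Omega\subset\mathbb{R}^d$ with Lebesgue measure $0<|\Omega|<\infty$: $\lambda(\Omega)=\min\{\int_\Omega|\nabla u|^2dx\,/\int_\Omega u^2dx : u\in H^1_0(\Omega),\ u\ne0\}$ is the first eigenvalue of the Dirichlet Laplacian; $T(\Omega)=\int_\Omega w_\Omega\,dx$ is the torsional rigidity, where $w_\Omega\in H^1_0(\Omega)$ is the unique weak solution of $-\Delta w=1$ in $\Omega$. For $q>0$, $$F_q(\Omega)=\frac{\lambda(\Omega)\,T(\Omega)^q}{|\Omega|^{(dq+2q-2)/d}}.$$ *)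

theory Defs
  imports "HOL-Analysis.Analysis"
begin

section \<open>Test functions\<close>

primrec C_k :: "nat \<Rightarrow> ('a::euclidean_space \<Rightarrow> real) \<Rightarrow> bool" where
  "C_k 0 f \<longleftrightarrow> continuous_on UNIV f"
| "C_k (Suc k) f \<longleftrightarrow>
     (\<forall>x. f differentiable (at x)) \<and>
     (\<forall>b\<in>Basis. C_k k (\<lambda>x. frechet_derivative f (at x) b))"

definition grad :: "('a::euclidean_space \<Rightarrow> real) \<Rightarrow> 'a \<Rightarrow> 'a" where
  "grad f x = (\<Sum>b\<in>Basis. frechet_derivative f (at x) b *\<^sub>R b)"

definition test_functions :: "'a::euclidean_space set \<Rightarrow> ('a \<Rightarrow> real) set" where
  "test_functions \<Omega> =
     {\<phi>. (\<forall>k. C_k k \<phi>) \<and> compact (closure {x. \<phi> x \<noteq> 0}) \<and> closure {x. \<phi> x \<noteq> 0} \<subseteq> \<Omega>}"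

section \<open>Sobolev spaces\<close>

text \<open>
  Elements of the function spaces on \<open>\<Omega>\<close> are represented by total functions, whose values
  outside \<open>\<Omega>\<close> are irrelevant; equality is equality almost everywhere on \<open>\<Omega>\<close>.
\<close>

definition L2 :: "'a::euclidean_space set \<Rightarrow> ('a \<Rightarrow> 'b::euclidean_space) set" where
  "L2 \<Omega> = {f \<in> borel_measurable (lebesgue_on \<Omega>).
            integrable (lebesgue_on \<Omega>) (\<lambda>x. (norm (f x))\<^sup>2)}"

text \<open>
  The weak gradient is determined only almost everywhere, so membership in the Sobolev spaces is
  stated as a relation: \<open>H1 \<Omega> u g\<close> says that \<open>u\<close> belongs to $H^1(\Omega)$ and that \<open>g\<close> is
  (a representative of) its weak gradient.
\<close>

definition H1 :: "'a::euclidean_space set \<Rightarrow> ('a \<Rightarrow> real) \<Rightarrow> ('a \<Rightarrow> 'a) \<Rightarrow> bool" where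
  "H1 \<Omega> u g \<longleftrightarrow> u \<in> L2 \<Omega> \<and> g \<in> L2 \<Omega> \<and>
     (\<forall>\<phi>\<in>test_functions \<Omega>. \<forall>b\<in>Basis.
        (LINT x|lebesgue_on \<Omega>. u x * (grad \<phi> x \<bullet> b)) =
        - (LINT x|lebesgue_on \<Omega>. (g x \<bullet> b) * \<phi> x))"

text \<open>$H^1_0(\Omega)$ is the closure of the test functions in the norm of $H^1(\Omega)$.\<close>

definition H10 :: "'a::euclidean_space set \<Rightarrow> ('a \<Rightarrow> real) \<Rightarrow> ('a \<Rightarrow> 'a) \<Rightarrow> bool" where
  "H10 \<Omega> u g \<longleftrightarrow> H1 \<Omega> u g \<and>
     (\<exists>\<phi>. (\<forall>n::nat. \<phi> n \<in> test_functions \<Omega>) \<and>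
        (\<lambda>n. (LINT x|lebesgue_on \<Omega>. (u x - \<phi> n x)\<^sup>2) +
             (LINT x|lebesgue_on \<Omega>. (norm (g x - grad (\<phi> n) x))\<^sup>2)) \<longlonglongrightarrow> 0)"

section \<open>First Dirichlet eigenvalue, torsional rigidity, and the functionals\<close>

text \<open>
  For open sets of finite positive measure the infimum is a minimum.
\<close>

definition dirichlet_eigenvalue :: "'a::euclidean_space set \<Rightarrow> real" where
  "dirichlet_eigenvalue \<Omega> =
     Inf {(LINT x|lebesgue_on \<Omega>. (norm (g x))\<^sup>2) / (LINT x|lebesgue_on \<Omega>. (u x)\<^sup>2) | u g.
          H10 \<Omega> u g \<and> \<not> (AE x in lebesgue_on \<Omega>. u x = 0)}"

text \<open>Weak solutions $w \in H^1_0(\Omega)$ of $-\Delta w = 1$ in $\Omega$.\<close>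

definition is_torsion_function :: "'a::euclidean_space set \<Rightarrow> ('a \<Rightarrow> real) \<Rightarrow> bool" where
  "is_torsion_function \<Omega> w \<longleftrightarrow>
     (\<exists>g. H10 \<Omega> w g \<and>
        (\<forall>v h. H10 \<Omega> v h \<longrightarrow>
           (LINT x|lebesgue_on \<Omega>. g x \<bullet> h x) = (LINT x|lebesgue_on \<Omega>. v x)))"

text \<open>
  The solution is unique only up to null sets, hence a choice; its integral does not depend on
  the representative.
\<close>

definition torsion_function :: "'a::euclidean_space set \<Rightarrow> 'a \<Rightarrow> real" where
  "torsion_function \<Omega> = (SOME w. is_torsion_function \<Omega> w)"

definition torsional_rigidity :: "'a::euclidean_space set \<Rightarrow> real" where
  "torsional_rigidity \<Omega> = (LINT x|lebesgue_on \<Omega>. torsion_function \<Omega> x)"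

definition F :: "real \<Rightarrow> 'a::euclidean_space set \<Rightarrow> real" where
  "F q \<Omega> =
     dirichlet_eigenvalue \<Omega> * torsional_rigidity \<Omega> powr q /
     measure lebesgue \<Omega> powr ((real DIM('a) * q + 2 * q - 2) / real DIM('a))"

end

theory Submission
  imports Defs
begin

text \<open>
  With \<open>T\<close> the torsional rigidity, \<open>F q \<Omega>\<close> is the product of \<open>\<lambda> T / |\<Omega>|\<close> and the
  \<open>(q - 1)\<close>-st power of \<open>T / |\<Omega>|\<^bsup>(d+2)/d\<^esup>\<close>. Testing the Rayleigh quotient with the torsion function
  \<open>w\<close>, for which \<open>\<integral> |\<nabla>w|\<^sup>2 = \<integral> w = T\<close>, and Cauchy-Schwarz bound the first factor by 1.
  The second factor is bounded by the Saint-Venant inequality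
  \<open>(\<integral> f)\<^sup>2 \<le> C |\<Omega>|\<^bsup>(d+2)/d\<^esup> \<integral> |\<nabla>f|\<^sup>2\<close> with the sharp constant. It is obtained without
  rearrangement: the Brunn-Minkowski inequality in dimension \<open>d + 1\<close>, applied to the
  subgraph of \<open>f\<close> and a small multiple of the subgraph of \<open>1 - |y|\<^sup>2\<close> over the unit ball, gives to first
  order a lower bound on \<open>|\<Omega>| + 1/4 \<integral> |\<nabla>f|\<^sup>2\<close>. Replacing the paraboloid by a
  cylinder gives an \<open>L\<^sup>1\<close> inequality, and, applied to \<open>f\<^sup>2\<close>, the Poincare inequality needed for
  the existence of \<open>w\<close>.
\<close>

section \<open>Brunn-Minkowski inequality\<close>


text \<open>The paraboloid is dictated by the equality case. On the unit ball the torsion function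
  is a multiple of \<open>1 - |y|^2\<close>; for \<open>f = 1 - |y|^2\<close> the two subgraphs
  coincide, so Brunn-Minkowski loses nothing. The maximum over \<open>y\<close> of
  \<open>1 - |y|^2 - v \<bullet> y\<close> is \<open>1 + |v|^2 / 4\<close>, attained at
  \<open>y = - v / 2\<close>; this convex conjugate is the origin of the factor 1/4. The resulting
  inequality is not homogeneous in \<open>f\<close>, so it is used for every multiple
  \<open>l * f\<close>, and optimizing over \<open>l\<close> restores the squares.

  Saint-Venant controls only the integral of \<open>f\<close>. That bounds the energy from below,
  but a minimizing sequence must also converge in the L2 norm, hence the Poincare inequality.
  Saint-Venant applied to \<open>f^2\<close> would leave the L2 norm of \<open>f |grad f|\<close> on
  the right, which the integral of \<open>f^2\<close> cannot absorb; the L1 bound leaves the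
  integral of \<open>|f| |grad f|\<close>, which it can. The eigenvalue enters only through an upper
  bound, so a single trial function suffices for it.\<close>

lemma emeasure_lborel_translate:
  fixes c :: real
  assumes "A \<in> sets borel"
  shows "(+) c ` A \<in> sets borel" "emeasure lborel ((+) c ` A) = emeasure lborel A"
proof -
  have eq: "(+) c ` A = (\<lambda>x. x - c) -` A \<inter> space borel"
    by force
  show b: "(+) c ` A \<in> sets borel"
    unfolding eq by (rule measurable_sets[OF _ assms]) simp
  have "emeasure lebesgue ((+) c ` A) = emeasure lebesgue A"
    using emeasure_lebesgue_affine[of 1 c A] by (simp add: add.commute image_def)
  with b assms show "emeasure lborel ((+) c ` A) = emeasure lborel A"
    by simp
qed

lemma emeasure_lborel_scale:
  fixes c :: real
  assumes "A \<in> sets borel" "c > 0"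
  shows "(*) c ` A \<in> sets borel" "emeasure lborel ((*) c ` A) = ennreal c * emeasure lborel A"
proof -
  have eq: "(*) c ` A = (\<lambda>x. x / c) -` A \<inter> space borel"
    using assms(2) by (auto simp: image_iff intro!: bexI[of _ "_ / c"])
  show b: "(*) c ` A \<in> sets borel"
    unfolding eq by (rule measurable_sets[OF _ assms(1)]) simp
  have "emeasure lebesgue ((*) c ` A) = ennreal c * emeasure lebesgue A"
    using emeasure_lebesgue_affine[of c 0 A] assms(2) by (simp add: image_def)
  with b assms show "emeasure lborel ((*) c ` A) = ennreal c * emeasure lborel A"
    by simp
qed

text \<open>Shift \<open>A\<close> by an almost smallest point \<open>b\<close> of \<open>B\<close>,
  and \<open>B\<close> by an almost largest point \<open>a\<close> of \<open>A\<close>. Both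
  translates lie in \<open>C\<close> and meet only within \<open>e/2\<close> of
  \<open>a + b\<close>, so up to \<open>e\<close> their measures add. A separate Borel set
  \<open>C\<close> stands for the sum because the sumset of two Borel sets need not be
  Borel.\<close>

lemma emeasure_Minkowski_sum_bdd:
  fixes A B C :: "real set"
  assumes [measurable]: "A \<in> sets borel" "B \<in> sets borel" "C \<in> sets borel"
    and ne: "A \<noteq> {}" "B \<noteq> {}" and bdd: "bdd_above A" "bdd_below B"
    and sub: "\<And>x y. x \<in> A \<Longrightarrow> y \<in> B \<Longrightarrow> x + y \<in> C"
  shows "emeasure lborel A + emeasure lborel B \<le> emeasure lborel C"
proof (rule ennreal_le_epsilon)
  fix e :: real assume e: "0 < e"
  obtain a where a: "a \<in> A" "Sup A - e/2 < a"
    using less_cSupD[OF ne(1), of "Sup A - e/2"] e by auto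
  obtain b where b: "b \<in> B" "b < Inf B + e/2"
    using cInf_lessD[OF ne(2), of "Inf B + e/2"] e by auto
  let ?A = "(+) b ` A" and ?B = "(+) a ` B" and ?I = "{a + b - e/2 .. a + b + e/2}"
  note [measurable] = emeasure_lborel_translate(1)[of A b] emeasure_lborel_translate(1)[of B a]
  have "?A \<inter> ?B \<subseteq> ?I"
  proof
    fix z assume "z \<in> ?A \<inter> ?B"
    then obtain x y where z: "x \<in> A" "y \<in> B" "z = b + x" "z = a + y" by auto
    then show "z \<in> ?I"
      using cSup_upper[OF z(1) bdd(1)] cInf_lower[OF z(2) bdd(2)] a b by auto
  qed
  then have i: "emeasure lborel (?A \<inter> ?B) \<le> ennreal e"
    using emeasure_mono[of "?A \<inter> ?B" ?I lborel] e by simp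
  have "emeasure lborel A + emeasure lborel B = emeasure lborel ?A + emeasure lborel ?B"
    by (simp add: emeasure_lborel_translate)
  also have "\<dots> = emeasure lborel (?A \<union> ?B) + emeasure lborel (?A \<inter> ?B)"
    by (rule emeasure_Un_Int) auto
  also have "\<dots> \<le> emeasure lborel C + ennreal e"
    using sub[OF _ b(1)] sub[OF a(1)] by (intro add_mono i emeasure_mono) (auto simp: add.commute[of b])
  finally show "emeasure lborel A + emeasure lborel B \<le> emeasure lborel C + ennreal e" .
qed

lemma emeasure_Minkowski_sum_real:
  fixes A B C :: "real set"
  assumes [measurable]: "A \<in> sets borel" "B \<in> sets borel" "C \<in> sets borel"
    and ne: "A \<noteq> {}" "B \<noteq> {}"
    and sub: "\<And>x y. x \<in> A \<Longrightarrow> y \<in> B \<Longrightarrow> x + y \<in> C"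
  shows "emeasure lborel A + emeasure lborel B \<le> emeasure lborel C"
proof -
  obtain a b where ab: "a \<in> A" "b \<in> B" using ne by auto
  \<comment> \<open>Only an upper bound on \<open>A\<close> and a lower bound on \<open>B\<close>
    have to be created. Anchoring the cutoffs at points of the sets keeps every truncation
    nonempty.\<close>
  define A' where "A' n = A \<inter> {..a + real n}" for n
  define B' where "B' n = B \<inter> {b - real n..}" for n
  have [measurable]: "A' n \<in> sets borel" "B' n \<in> sets borel" for n
    unfolding A'_def B'_def by auto
  have "(\<Union>n. A' n) = A"
    unfolding A'_def by (auto, metis diff_le_eq add.commute real_arch_simple)
  moreover have "incseq A'"
    unfolding A'_def by (fastforce intro!: incseq_SucI)
  ultimately have 1: "(\<lambda>n. emeasure lborel (A' n)) \<longlonglongrightarrow> emeasure lborel A"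
    using Lim_emeasure_incseq[of A' lborel] by (auto simp: image_subset_iff)
  have "(\<Union>n. B' n) = B"
    unfolding B'_def by (auto, metis diff_le_eq add.commute real_arch_simple)
  moreover have "incseq B'"
    unfolding B'_def by (fastforce intro!: incseq_SucI)
  ultimately have 2: "(\<lambda>n. emeasure lborel (B' n)) \<longlonglongrightarrow> emeasure lborel B"
    using Lim_emeasure_incseq[of B' lborel] by (auto simp: image_subset_iff)
  have "emeasure lborel (A' n) + emeasure lborel (B' n) \<le> emeasure lborel C" for n
  proof (rule emeasure_Minkowski_sum_bdd)
    show "A' n \<noteq> {}" "B' n \<noteq> {}" using ab unfolding A'_def B'_def by auto
    show "bdd_above (A' n)" "bdd_below (B' n)" unfolding A'_def B'_def by auto
    show "x + y \<in> C" if "x \<in> A' n" "y \<in> B' n" for x y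
      using that sub unfolding A'_def B'_def by auto
  qed simp_all
  then show ?thesis
    by (intro LIMSEQ_le_const2[OF tendsto_add[OF 1 2]]) auto
qed

section \<open>Layer cake formula with normalized levels\<close>

lemma nn_integral_level_min:
  fixes y :: ennreal
  assumes c: "c > 0"
  shows "ennreal c * (\<integral>\<^sup>+\<mu>. indicator {0..1} \<mu> * indicator {\<mu>. ennreal (c * \<mu>) < y} \<mu> \<partial>lborel) = min y (ennreal c)"
proof (cases "y < ennreal c")
  case True
  then obtain r where r: "y = ennreal r" "0 \<le> r" "r < c"
    by (cases y) (auto simp: ennreal_less_iff top_unique)
  have "indicator {0..1} \<mu> * indicator {\<mu>. ennreal (c * \<mu>) < y} \<mu> = (indicator {0..<r/c} \<mu> :: ennreal)" for \<mu>
  proof -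
    have "c * \<mu> < r \<longleftrightarrow> \<mu> < r / c" "c * \<mu> < r \<longrightarrow> \<mu> \<le> 1"
      using r c mult_left_mono[of 1 \<mu> c] by (fastforce simp: field_simps not_le)+
    then show ?thesis
      using r c by (cases "0 \<le> \<mu>") (auto simp: indicator_def ennreal_less_iff)
  qed
  then have "(\<integral>\<^sup>+\<mu>. indicator {0..1} \<mu> * indicator {\<mu>. ennreal (c * \<mu>) < y} \<mu> \<partial>lborel) = ennreal (r/c)"
    using r c by simp
  then show ?thesis using r c True by (simp flip: ennreal_mult')
next
  case False
  have "(\<integral>\<^sup>+\<mu>. indicator {0..1} \<mu> * indicator {\<mu>. ennreal (c * \<mu>) < y} \<mu> \<partial>lborel)
      = (\<integral>\<^sup>+\<mu>. indicator {0..1} \<mu> \<partial>(lborel::real measure))"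
  proof (rule nn_integral_cong_AE)
    \<comment> \<open>At \<open>\<mu> = 1\<close> the level is \<open>c\<close> itself, which is not
      strictly below \<open>y\<close> when \<open>y = c\<close>; this single point is
      discarded.\<close>
    have "AE \<mu> in lborel. \<mu> \<noteq> (1::real)" by (rule AE_lborel_singleton)
    then show "AE \<mu> in lborel. indicator {0..1} \<mu> * indicator {\<mu>. ennreal (c * \<mu>) < y} \<mu> = (indicator {0..1} \<mu> :: ennreal)"
    proof eventually_elim
      case (elim \<mu>)
      show ?case
      proof (cases "\<mu> \<in> {0..1}")
        case True
        then have "ennreal (c * \<mu>) < ennreal c" using c elim by (auto simp: ennreal_less_iff)
        then show ?thesis using False by auto
      qed auto
    qed
  qed
  then show ?thesis using False by (simp add: min_def)
qed

text \<open>Tonelli applied to the pointwise identity. Levels are written \<open>c * \<mu>\<close>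
  with \<open>\<mu>\<close> in the unit interval so that functions with different suprema can be
  compared at the same \<open>\<mu>\<close>.\<close>

lemma nn_integral_layer_cake:
  assumes "sigma_finite_measure M" and [measurable]: "f \<in> borel_measurable M" and c: "c > 0"
  shows "(\<integral>\<^sup>+x. min (f x) (ennreal c) \<partial>M) =
    ennreal c * (\<integral>\<^sup>+\<mu>. indicator {0..1} \<mu> * emeasure M {x\<in>space M. ennreal (c * \<mu>) < f x} \<partial>lborel)"
proof -
  interpret sigma_finite_measure M by fact
  interpret pair_sigma_finite lborel M by standard
  have "(\<integral>\<^sup>+x. min (f x) (ennreal c) \<partial>M) =
    (\<integral>\<^sup>+x. ennreal c * (\<integral>\<^sup>+\<mu>. indicator {0..1} \<mu> * indicator {\<mu>. ennreal (c * \<mu>) < f x} \<mu> \<partial>lborel) \<partial>M)"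
    by (simp add: nn_integral_level_min[OF c])
  also have "\<dots> = ennreal c * (\<integral>\<^sup>+x. (\<integral>\<^sup>+\<mu>. indicator {0..1} \<mu> * indicator {\<mu>. ennreal (c * \<mu>) < f x} \<mu> \<partial>lborel) \<partial>M)"
    by (rule nn_integral_cmult) measurable
  also have "(\<integral>\<^sup>+x. (\<integral>\<^sup>+\<mu>. indicator {0..1} \<mu> * indicator {\<mu>. ennreal (c * \<mu>) < f x} \<mu> \<partial>lborel) \<partial>M)
     = (\<integral>\<^sup>+\<mu>. (\<integral>\<^sup>+x. indicator {0..1} \<mu> * indicator {\<mu>. ennreal (c * \<mu>) < f x} \<mu> \<partial>M) \<partial>lborel)"
    by (rule Fubini') measurable
  also have "\<dots> = (\<integral>\<^sup>+\<mu>. indicator {0..1} \<mu> * emeasure M {x\<in>space M. ennreal (c * \<mu>) < f x} \<partial>lborel)"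
  proof (rule nn_integral_cong)
    fix \<mu> :: real
    have "(\<integral>\<^sup>+x. indicator {0..1} \<mu> * indicator {\<mu>. ennreal (c * \<mu>) < f x} \<mu> \<partial>M)
      = (\<integral>\<^sup>+x. indicator {0..1} \<mu> * indicator {x\<in>space M. ennreal (c * \<mu>) < f x} x \<partial>M)"
      by (rule nn_integral_cong) (auto simp: indicator_def)
    also have "\<dots> = indicator {0..1} \<mu> * emeasure M {x\<in>space M. ennreal (c * \<mu>) < f x}"
      by (subst nn_integral_cmult) auto
    finally show "(\<integral>\<^sup>+x. indicator {0..1} \<mu> * indicator {\<mu>. ennreal (c * \<mu>) < f x} \<mu> \<partial>M) = \<dots>" .
  qed
  finally show ?thesis .
qed


section \<open>Prekopa-Leindler inequality\<close>

lemma ennreal_between: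
  fixes y :: ennreal
  assumes "ennreal r < y" "0 \<le> r"
  obtains a where "r < a" "ennreal a \<le> y"
proof (cases "y = \<infinity>")
  case True
  then show ?thesis using that[of "r + 1"] by simp
next
  case False
  then obtain s where "y = ennreal s" "0 \<le> s" by (cases y) auto
  then show ?thesis using assms that[of s] by (simp add: ennreal_less_iff)
qed

text \<open>
  In the Prekopa-Leindler inequalities below, quantifying over finite minorants \<open>a\<close>, \<open>b\<close> avoids
  real powers of extended reals.
\<close>

lemma Prekopa_Leindler_bounded:
  fixes f g h :: "real \<Rightarrow> ennreal"
  assumes t: "0 < t" "t < 1"
    and [measurable]: "f \<in> borel_measurable borel" "g \<in> borel_measurable borel" "h \<in> borel_measurable borel"
    and fgh: "\<And>x y a b. 0 < a \<Longrightarrow> 0 < b \<Longrightarrow> ennreal a \<le> f x \<Longrightarrow> ennreal b \<le> g y \<Longrightarrow>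
      ennreal (a powr (1-t) * b powr t) \<le> h ((1-t) * x + t * y)"
    and ab: "0 < a" "0 < b" "ennreal a \<le> (\<integral>\<^sup>+x. f x \<partial>lborel)" "ennreal b \<le> (\<integral>\<^sup>+x. g x \<partial>lborel)"
    and P: "(SUP x. f x) = ennreal P" "0 < P" and Q: "(SUP x. g x) = ennreal Q" "0 < Q"
  shows "ennreal (a powr (1-t) * b powr t) \<le> (\<integral>\<^sup>+x. h x \<partial>lborel)"
proof -
  \<comment> \<open>Dividing \<open>f\<close>, \<open>g\<close>, \<open>h\<close> by
    \<open>P\<close>, \<open>Q\<close>, \<open>H\<close> normalizes the suprema of \<open>f\<close>
    and \<open>g\<close> to 1 and preserves the multiplicative hypothesis. Equal suprema are what
    makes the superlevel sets of both functions nonempty for the same \<open>\<mu>\<close>.\<close>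
  define H where "H = P powr (1-t) * Q powr t"
  have H: "H > 0" using P Q by (simp add: H_def)
  define A where "A \<mu> = {x. ennreal (P * \<mu>) < f x}" for \<mu>
  define B where "B \<mu> = {x. ennreal (Q * \<mu>) < g x}" for \<mu>
  define C where "C \<mu> = {x. ennreal (H * \<mu>) < h x}" for \<mu>
  have [measurable]: "A \<mu> \<in> sets borel" "B \<mu> \<in> sets borel" "C \<mu> \<in> sets borel" for \<mu>
    unfolding A_def B_def C_def by measurable
  \<comment> \<open>The hypothesis puts the combination of \<open>A \<mu>\<close> and
    \<open>B \<mu>\<close> with weights \<open>1-t\<close> and \<open>t\<close> inside
    \<open>C \<mu>\<close>, so the claim is the one-dimensional sumset inequality. Strictness of
    \<open>\<mu> < 1\<close> ensures that both sets are nonempty.\<close>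
  have level: "ennreal (1-t) * emeasure lborel (A \<mu>) + ennreal t * emeasure lborel (B \<mu>) \<le> emeasure lborel (C \<mu>)"
    if \<mu>: "0 \<le> \<mu>" "\<mu> < 1" for \<mu>
  proof -
    have "ennreal (P * \<mu>) < (SUP x. f x)" "ennreal (Q * \<mu>) < (SUP x. g x)"
      using P Q \<mu> by (auto simp: ennreal_less_iff)
    then have ne: "A \<mu> \<noteq> {}" "B \<mu> \<noteq> {}"
      by (auto simp: A_def B_def less_SUP_iff)
    have [measurable]: "(*) (1-t) ` A \<mu> \<in> sets borel" "(*) t ` B \<mu> \<in> sets borel"
      using t by (auto intro!: emeasure_lborel_scale)
    have "emeasure lborel ((*) (1-t) ` A \<mu>) + emeasure lborel ((*) t ` B \<mu>) \<le> emeasure lborel (C \<mu>)"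
    proof (rule emeasure_Minkowski_sum_real)
      fix x y assume "x \<in> (*) (1-t) ` A \<mu>" "y \<in> (*) t ` B \<mu>"
      then obtain u v where uv: "x = (1-t) * u" "y = t * v" "ennreal (P * \<mu>) < f u" "ennreal (Q * \<mu>) < g v"
        by (auto simp: A_def B_def)
      obtain p where p: "P * \<mu> < p" "ennreal p \<le> f u"
        using ennreal_between[OF uv(3)] P \<mu> by auto
      obtain q where q: "Q * \<mu> < q" "ennreal q \<le> g v"
        using ennreal_between[OF uv(4)] Q \<mu> by auto
      have pos: "0 < p" "0 < q" using p q P Q \<mu> by (meson le_less_trans less_imp_le mult_nonneg_nonneg)+
      have "H * \<mu> = (P * \<mu>) powr (1-t) * (Q * \<mu>) powr t"
      proof -
        have "\<mu> powr (1-t) * \<mu> powr t = \<mu>"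
          using \<mu> by (cases "\<mu> = 0") (auto simp flip: powr_add)
        then show ?thesis
          using P Q \<mu> unfolding H_def by (simp add: powr_mult)
      qed
      also have "\<dots> < p powr (1-t) * q powr t"
        using p q P Q \<mu> t pos by (intro mult_strict_mono powr_less_mono2) auto
      finally have "ennreal (H * \<mu>) < ennreal (p powr (1-t) * q powr t)"
        using H \<mu> by (auto simp: ennreal_less_iff)
      also have "\<dots> \<le> h (x + y)"
        using fgh[OF pos p(2) q(2)] by (simp add: uv)
      finally show "x + y \<in> C \<mu>" by (simp add: C_def)
    qed (use ne in auto)
    then show ?thesis using t by (simp add: emeasure_lborel_scale)
  qed
  define \<phi> where "\<phi> = (\<integral>\<^sup>+\<mu>. indicator {0..1} \<mu> * emeasure lborel (A \<mu>) \<partial>lborel)"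
  define \<psi> where "\<psi> = (\<integral>\<^sup>+\<mu>. indicator {0..1} \<mu> * emeasure lborel (B \<mu>) \<partial>lborel)"
  define \<omega> where "\<omega> = (\<integral>\<^sup>+\<mu>. indicator {0..1} \<mu> * emeasure lborel (C \<mu>) \<partial>lborel)"
  have lc: "(\<integral>\<^sup>+x. min (u x) (ennreal c) \<partial>lborel) =
    ennreal c * (\<integral>\<^sup>+\<mu>. indicator {0..1} \<mu> * emeasure lborel {x. ennreal (c * \<mu>) < u x} \<partial>lborel)"
    if "c > 0" "u \<in> borel_measurable borel" for c :: real and u :: "real \<Rightarrow> ennreal"
    using nn_integral_layer_cake[of lborel u c] that by (simp add: lborel.sigma_finite_measure_axioms)
  have f\<phi>: "ennreal P * \<phi> = (\<integral>\<^sup>+x. f x \<partial>lborel)"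
  proof -
    have "min (f x) (ennreal P) = f x" for x using P by (metis SUP_upper UNIV_I min.absorb1)
    then show ?thesis using lc[of P f] P by (simp add: \<phi>_def A_def)
  qed
  have g\<psi>: "ennreal Q * \<psi> = (\<integral>\<^sup>+x. g x \<partial>lborel)"
  proof -
    have "min (g x) (ennreal Q) = g x" for x using Q by (metis SUP_upper UNIV_I min.absorb1)
    then show ?thesis using lc[of Q g] Q by (simp add: \<psi>_def B_def)
  qed
  have meas[measurable]: "(\<lambda>\<mu>. emeasure lborel (A \<mu>)) \<in> borel_measurable borel"
     "(\<lambda>\<mu>. emeasure lborel (B \<mu>)) \<in> borel_measurable borel"
    unfolding A_def B_def by measurable
  have "ennreal (1-t) * \<phi> + ennreal t * \<psi> =
    (\<integral>\<^sup>+\<mu>. ennreal (1-t) * (indicator {0..1} \<mu> * emeasure lborel (A \<mu>)) + ennreal t * (indicator {0..1} \<mu> * emeasure lborel (B \<mu>)) \<partial>lborel)"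
    unfolding \<phi>_def \<psi>_def by (simp add: nn_integral_add nn_integral_cmult)
  also have "\<dots> \<le> \<omega>"
    unfolding \<omega>_def
  proof (rule nn_integral_mono_AE)
    have "AE \<mu> in lborel. \<mu> \<noteq> (1::real)" by (rule AE_lborel_singleton)
    then show "AE \<mu> in lborel. ennreal (1-t) * (indicator {0..1} \<mu> * emeasure lborel (A \<mu>)) + ennreal t * (indicator {0..1} \<mu> * emeasure lborel (B \<mu>))
       \<le> indicator {0..1} \<mu> * emeasure lborel (C \<mu>)"
      by eventually_elim (use level in \<open>auto simp: indicator_def\<close>)
  qed
  finally have key: "ennreal (1-t) * \<phi> + ennreal t * \<psi> \<le> \<omega>" .
  have "ennreal (a / P) \<le> \<phi>"
  proof -
    have "ennreal (a / P) = ennreal (1 / P) * ennreal a" using P by (simp flip: ennreal_mult')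
    also have "\<dots> \<le> ennreal (1 / P) * (ennreal P * \<phi>)" unfolding f\<phi> by (intro mult_left_mono ab) auto
    also have "\<dots> = \<phi>" using P by (simp add: mult.assoc[symmetric] flip: ennreal_mult')
    finally show ?thesis .
  qed
  moreover have "ennreal (b / Q) \<le> \<psi>"
  proof -
    have "ennreal (b / Q) = ennreal (1 / Q) * ennreal b" using Q by (simp flip: ennreal_mult')
    also have "\<dots> \<le> ennreal (1 / Q) * (ennreal Q * \<psi>)" unfolding g\<psi> by (intro mult_left_mono ab) auto
    also have "\<dots> = \<psi>" using Q by (simp add: mult.assoc[symmetric] flip: ennreal_mult')
    finally show ?thesis .
  qed
  ultimately have "ennreal (1-t) * ennreal (a / P) + ennreal t * ennreal (b / Q) \<le> \<omega>"
    by (intro order.trans[OF _ key] add_mono mult_left_mono) auto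
  then have \<omega>: "ennreal ((1-t) * (a / P) + t * (b / Q)) \<le> \<omega>"
    using t ab P Q by (simp flip: ennreal_mult' ennreal_plus)
  have "a powr (1-t) * b powr t = H * ((a / P) powr (1-t) * (b / Q) powr t)"
    using P Q ab by (simp add: H_def powr_divide)
  \<comment> \<open>After normalization the integrals satisfy an inequality with the arithmetic mean
    on the left; weighted AM-GM weakens it to the geometric mean.\<close>
  also have "\<dots> \<le> H * ((1-t) * (a / P) + t * (b / Q))"
    using H t ab P Q by (intro mult_left_mono Youngs_inequality_0) auto
  finally have "ennreal (a powr (1-t) * b powr t) \<le> ennreal H * ennreal ((1-t) * (a / P) + t * (b / Q))"
    using H by (simp flip: ennreal_mult' add: ennreal_leI)
  also have "\<dots> \<le> ennreal H * \<omega>" by (intro mult_left_mono \<omega>) auto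
  also have "\<dots> = (\<integral>\<^sup>+x. min (h x) (ennreal H) \<partial>lborel)"
    using lc[of H h] H by (simp add: \<omega>_def C_def)
  also have "\<dots> \<le> (\<integral>\<^sup>+x. h x \<partial>lborel)"
    by (intro nn_integral_mono) auto
  finally show ?thesis .
qed

lemma nn_integral_truncate_gt:
  fixes f :: "'a \<Rightarrow> ennreal"
  assumes [measurable]: "f \<in> borel_measurable M" and "x < (\<integral>\<^sup>+x. f x \<partial>M)"
  obtains n :: nat where "x < (\<integral>\<^sup>+x. min (f x) (of_nat n) \<partial>M)"
proof -
  have "(\<integral>\<^sup>+x. f x \<partial>M) = (\<integral>\<^sup>+x. (SUP n. min (f x) (of_nat n)) \<partial>M)"
  proof (rule nn_integral_cong)
    fix y
    show "f y = (SUP n. min (f y) (of_nat n))"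
    proof (cases "f y = \<infinity>")
      case True
      then show ?thesis by (simp add: min_def ennreal_SUP_of_nat_eq_top top_unique cong: SUP_cong)
    next
      case False
      then obtain n :: nat where "f y \<le> of_nat n"
        using ennreal_Ex_less_of_nat by (metis infinity_ennreal_def top.not_eq_extremum less_imp_le)
      then have "min (f y) (of_nat n) = f y" by simp
      then show ?thesis
        by (intro antisym SUP_least) (metis SUP_upper UNIV_I, simp)
    qed
  qed
  also have "\<dots> = (SUP n. (\<integral>\<^sup>+x. min (f x) (of_nat n) \<partial>M))"
    by (rule nn_integral_monotone_convergence_SUP)
      (auto simp: incseq_def le_fun_def intro: min.coboundedI2)
  finally show ?thesis using assms(2) that by (auto simp: less_SUP_iff)
qed

lemma ennreal_truncated_SUP_pos:
  fixes f :: "real \<Rightarrow> ennreal"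
  assumes "0 < (\<integral>\<^sup>+x. min (f x) (of_nat n) \<partial>lborel)"
  obtains P where "(SUP x. min (f x) (of_nat n)) = ennreal P" "0 < P"
proof -
  have "(SUP x. min (f x) (of_nat n)) \<le> of_nat n" by (rule SUP_least) simp
  also have "\<dots> < top" by (rule of_nat_less_top)
  finally obtain P where P: "(SUP x. min (f x) (of_nat n)) = ennreal P" "0 \<le> P"
    by (cases "SUP x. min (f x) (of_nat n)") auto
  have "P \<noteq> 0"
  proof
    assume "P = 0"
    then have "min (f x) (of_nat n) = 0" for x
      using P by (metis SUP_upper UNIV_I ennreal_0 le_zero_eq)
    then show False using assms by simp
  qed
  then show ?thesis using P that by simp
qed

text \<open>Boundedness is removed by truncation: for \<open>r < 1\<close> some truncations of
  \<open>f\<close> and \<open>g\<close> still have integrals above \<open>r * a\<close> and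
  \<open>r * b\<close>, and their minorants are minorants of \<open>f\<close> and \<open>g\<close>.
  The mean is homogeneous of degree one, so only the factor \<open>r\<close> is lost, and it tends
  to 1.\<close>

lemma Prekopa_Leindler_real:
  fixes f g h :: "real \<Rightarrow> ennreal"
  assumes t: "0 < t" "t < 1"
    and [measurable]: "f \<in> borel_measurable borel" "g \<in> borel_measurable borel" "h \<in> borel_measurable borel"
    and fgh: "\<And>x y a b. 0 < a \<Longrightarrow> 0 < b \<Longrightarrow> ennreal a \<le> f x \<Longrightarrow> ennreal b \<le> g y \<Longrightarrow>
      ennreal (a powr (1-t) * b powr t) \<le> h ((1-t) * x + t * y)"
    and ab: "0 < a" "0 < b" "ennreal a \<le> (\<integral>\<^sup>+x. f x \<partial>lborel)" "ennreal b \<le> (\<integral>\<^sup>+x. g x \<partial>lborel)"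
  shows "ennreal (a powr (1-t) * b powr t) \<le> (\<integral>\<^sup>+x. h x \<partial>lborel)"
proof (rule ennreal_approx_unit)
  fix c :: ennreal assume "0 < c" "c < 1"
  then obtain r where r: "c = ennreal r" "0 < r" "r < 1"
    by (cases c) (auto simp: ennreal_less_iff)
  have "ennreal (r * a) < (\<integral>\<^sup>+x. f x \<partial>lborel)"
    by (rule less_le_trans[OF _ ab(3)]) (use r ab in \<open>simp add: ennreal_less_iff\<close>)
  then obtain m where m: "ennreal (r * a) < (\<integral>\<^sup>+x. min (f x) (of_nat m) \<partial>lborel)"
    using nn_integral_truncate_gt[of f lborel] by auto
  have "ennreal (r * b) < (\<integral>\<^sup>+x. g x \<partial>lborel)"
    by (rule less_le_trans[OF _ ab(4)]) (use r ab in \<open>simp add: ennreal_less_iff\<close>)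
  then obtain n where n: "ennreal (r * b) < (\<integral>\<^sup>+x. min (g x) (of_nat n) \<partial>lborel)"
    using nn_integral_truncate_gt[of g lborel] by auto
  obtain P where P: "(SUP x. min (f x) (of_nat m)) = ennreal P" "0 < P"
    using ennreal_truncated_SUP_pos m le_less_trans zero_le by metis
  obtain Q where Q: "(SUP x. min (g x) (of_nat n)) = ennreal Q" "0 < Q"
    using ennreal_truncated_SUP_pos n le_less_trans zero_le by metis
  have "ennreal ((r * a) powr (1-t) * (r * b) powr t) \<le> (\<integral>\<^sup>+x. h x \<partial>lborel)"
    by (rule Prekopa_Leindler_bounded[OF t _ _ _ _ _ _ _ _ P Q])
      (use m n r ab in \<open>auto intro: fgh less_imp_le\<close>)
  also have "(r * a) powr (1-t) * (r * b) powr t = (r powr (1-t) * r powr t) * (a powr (1-t) * b powr t)"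
    using r ab by (simp add: powr_mult)
  also have "r powr (1-t) * r powr t = r" using r by (simp flip: powr_add)
  finally show "c * ennreal (a powr (1-t) * b powr t) \<le> (\<integral>\<^sup>+x. h x \<partial>lborel)"
    using r by (simp add: ennreal_mult')
qed


text \<open>Induction on the number of coordinates. The induction hypothesis on the slices at
  heights \<open>s\<close> and \<open>r\<close> says exactly that the slice integrals, as functions
  of the height, satisfy the one-dimensional hypothesis; the formulation with minorants makes the
  two match literally. Over the empty index set the integral is evaluation at the only
  point.\<close>

lemma Prekopa_Leindler_PiM:
  fixes f g h :: "('i \<Rightarrow> real) \<Rightarrow> ennreal"
  assumes t: "0 < t" "t < 1" and "finite I"
    and "f \<in> borel_measurable (Pi\<^sub>M I (\<lambda>_. lborel))" "g \<in> borel_measurable (Pi\<^sub>M I (\<lambda>_. lborel))"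
      "h \<in> borel_measurable (Pi\<^sub>M I (\<lambda>_. lborel))"
    and "\<And>x y a b. x \<in> extensional I \<Longrightarrow> y \<in> extensional I \<Longrightarrow> 0 < a \<Longrightarrow> 0 < b \<Longrightarrow>
      ennreal a \<le> f x \<Longrightarrow> ennreal b \<le> g y \<Longrightarrow>
      ennreal (a powr (1-t) * b powr t) \<le> h (\<lambda>i\<in>I. (1-t) * x i + t * y i)"
    and "0 < a" "0 < b" "ennreal a \<le> (\<integral>\<^sup>+x. f x \<partial>Pi\<^sub>M I (\<lambda>_. lborel))" "ennreal b \<le> (\<integral>\<^sup>+x. g x \<partial>Pi\<^sub>M I (\<lambda>_. lborel))"
  shows "ennreal (a powr (1-t) * b powr t) \<le> (\<integral>\<^sup>+x. h x \<partial>Pi\<^sub>M I (\<lambda>_. lborel))"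
  using assms(3-)
proof (induction I arbitrary: f g h a b rule: finite_induct)
  case empty
  interpret product_sigma_finite "\<lambda>_. lborel :: real measure" by standard
  show ?case
    using empty.prems(4)[of "\<lambda>_. undefined" "\<lambda>_. undefined" a b] empty.prems
    by (simp add: nn_integral_empty restrict_def)
next
  case (insert i I)
  interpret product_sigma_finite "\<lambda>_. lborel :: real measure" by standard
  interpret PI: sigma_finite_measure "Pi\<^sub>M I (\<lambda>_. lborel :: real measure)"
    by (rule sigma_finite) fact
  note [measurable] = insert.prems(1-3)
  have ins: "(\<integral>\<^sup>+x. u x \<partial>Pi\<^sub>M (insert i I) (\<lambda>_. lborel)) = (\<integral>\<^sup>+y. (\<integral>\<^sup>+x. u (x(i := y)) \<partial>Pi\<^sub>M I (\<lambda>_. lborel)) \<partial>lborel)"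
    if "u \<in> borel_measurable (Pi\<^sub>M (insert i I) (\<lambda>_. lborel))" for u :: "('i \<Rightarrow> real) \<Rightarrow> ennreal"
    using product_nn_integral_insert_rev[OF insert.hyps(1,2) that] .
  show ?case
    unfolding ins[OF insert.prems(3)]
  proof (rule Prekopa_Leindler_real[OF t, where
        f = "\<lambda>s. \<integral>\<^sup>+x. f (x(i := s)) \<partial>Pi\<^sub>M I (\<lambda>_. lborel)" and g = "\<lambda>s. \<integral>\<^sup>+x. g (x(i := s)) \<partial>Pi\<^sub>M I (\<lambda>_. lborel)"])
    show "(\<lambda>s. \<integral>\<^sup>+x. f (x(i := s)) \<partial>Pi\<^sub>M I (\<lambda>_. lborel)) \<in> borel_measurable borel"
      "(\<lambda>s. \<integral>\<^sup>+x. g (x(i := s)) \<partial>Pi\<^sub>M I (\<lambda>_. lborel)) \<in> borel_measurable borel"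
      "(\<lambda>s. \<integral>\<^sup>+x. h (x(i := s)) \<partial>Pi\<^sub>M I (\<lambda>_. lborel)) \<in> borel_measurable borel"
      by measurable
    show "0 < a" "0 < b" by fact+
    show "ennreal a \<le> (\<integral>\<^sup>+s. (\<integral>\<^sup>+x. f (x(i := s)) \<partial>Pi\<^sub>M I (\<lambda>_. lborel)) \<partial>lborel)"
         "ennreal b \<le> (\<integral>\<^sup>+s. (\<integral>\<^sup>+x. g (x(i := s)) \<partial>Pi\<^sub>M I (\<lambda>_. lborel)) \<partial>lborel)"
      using insert.prems by (simp_all add: ins)
  next
    fix s r p q :: real
    assume pq: "0 < p" "0 < q"
      "ennreal p \<le> (\<integral>\<^sup>+x. f (x(i := s)) \<partial>Pi\<^sub>M I (\<lambda>_. lborel))"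
      "ennreal q \<le> (\<integral>\<^sup>+x. g (x(i := r)) \<partial>Pi\<^sub>M I (\<lambda>_. lborel))"
    have [measurable]: "(\<lambda>x. x(i := c)) \<in> Pi\<^sub>M I (\<lambda>_. lborel) \<rightarrow>\<^sub>M Pi\<^sub>M (insert i I) (\<lambda>_. lborel)" for c :: real
      by (rule measurable_fun_upd[where J = I]) auto
    show "ennreal (p powr (1-t) * q powr t) \<le> (\<integral>\<^sup>+x. h (x(i := (1-t) * s + t * r)) \<partial>Pi\<^sub>M I (\<lambda>_. lborel))"
    proof (rule insert.IH[OF _ _ _ _ pq])
      fix x y c d
      assume xy: "x \<in> extensional I" "y \<in> extensional I" "0 < c" "0 < d"
         "ennreal c \<le> f (x(i := s))" "ennreal d \<le> g (y(i := r))"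
      have e: "x(i := s) \<in> extensional (insert i I)" "y(i := r) \<in> extensional (insert i I)"
        using xy by (auto simp: extensional_def)
      have "(\<lambda>j\<in>insert i I. (1-t) * (x(i := s)) j + t * (y(i := r)) j)
         = (\<lambda>j\<in>I. (1-t) * x j + t * y j)(i := (1-t) * s + t * r)"
        using insert.hyps by (auto simp: restrict_def fun_eq_iff)
      then show "ennreal (c powr (1-t) * d powr t) \<le> h ((\<lambda>j\<in>I. (1-t) * x j + t * y j)(i := (1-t) * s + t * r))"
        using insert.prems(4)[OF e xy(3-6)] by (simp only:)
    qed measurable
  qed
qed

text \<open>The functional inequality for indicators, read in coordinates. A positive minorant of an
  indicator forces membership and is at most 1, so the weighted mean of two of them is below the
  indicator of \<open>C\<close>.\<close>

lemma Prekopa_Leindler_sets: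
  fixes A B C :: "'a::euclidean_space set"
  assumes t: "0 < t" "t < 1" and [measurable]: "A \<in> sets borel" "B \<in> sets borel" "C \<in> sets borel"
    and sub: "\<And>x y. x \<in> A \<Longrightarrow> y \<in> B \<Longrightarrow> (1-t) *\<^sub>R x + t *\<^sub>R y \<in> C"
    and ab: "0 < a" "0 < b" "ennreal a \<le> emeasure lborel A" "ennreal b \<le> emeasure lborel B"
  shows "ennreal (a powr (1-t) * b powr t) \<le> emeasure lborel C"
proof -
  let ?P = "Pi\<^sub>M (Basis :: 'a set) (\<lambda>_. lborel :: real measure)"
  define T :: "('a \<Rightarrow> real) \<Rightarrow> 'a" where "T p = (\<Sum>b\<in>Basis. p b *\<^sub>R b)" for p
  have [measurable]: "T \<in> ?P \<rightarrow>\<^sub>M borel" unfolding T_def by measurable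
  have em: "emeasure lborel D = (\<integral>\<^sup>+p. indicator D (T p) \<partial>?P)" if [measurable]: "D \<in> sets borel" for D
  proof -
    have "emeasure lborel D = (\<integral>\<^sup>+x. indicator D x \<partial>distr ?P borel T)"
      using that by (simp add: lborel_eq[where 'a='a] T_def[abs_def])
    also have "\<dots> = (\<integral>\<^sup>+p. indicator D (T p) \<partial>?P)"
      by (rule nn_integral_distr) measurable
    finally show ?thesis .
  qed
  have T_comb: "T (\<lambda>i\<in>Basis. (1-t) * x i + t * y i) = (1-t) *\<^sub>R T x + t *\<^sub>R T y" for x y
    by (simp add: T_def sum.distrib scaleR_left_distrib scaleR_sum_right)
  show ?thesis
    unfolding em[OF assms(5)]
  proof (rule Prekopa_Leindler_PiM[OF t, where f = "\<lambda>p. indicator A (T p)" and g = "\<lambda>p. indicator B (T p)"])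
    fix x y c d
    assume cd: "0 < c" "0 < d" "ennreal c \<le> indicator A (T x)" "ennreal d \<le> indicator B (T y)"
    have "T x \<in> A" "c \<le> 1" "T y \<in> B" "d \<le> 1"
      using cd by (auto simp: indicator_def of_bool_def split: if_splits)
    then have "(1-t) *\<^sub>R T x + t *\<^sub>R T y \<in> C" by (intro sub)
    moreover have "c powr (1-t) * d powr t \<le> 1"
      using cd t \<open>c \<le> 1\<close> \<open>d \<le> 1\<close> by (intro mult_le_one powr_le1) auto
    ultimately show "ennreal (c powr (1-t) * d powr t) \<le> indicator C (T (\<lambda>i\<in>Basis. (1-t) * x i + t * y i))"
      by (simp add: T_comb)
  qed (use ab em in auto)
qed

section \<open>Brunn-Minkowski inequality in every dimension\<close>

lemma emeasure_lborel_scaleR: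
  fixes A :: "'a::euclidean_space set"
  assumes "A \<in> sets borel" "c > 0"
  shows "(*\<^sub>R) c ` A \<in> sets borel" "emeasure lborel ((*\<^sub>R) c ` A) = ennreal (c ^ DIM('a)) * emeasure lborel A"
proof -
  have eq: "(*\<^sub>R) c ` A = (\<lambda>x. x /\<^sub>R c) -` A \<inter> space borel"
    using assms(2) by (auto simp: image_iff intro!: bexI[of _ "_ /\<^sub>R c"])
  show b: "(*\<^sub>R) c ` A \<in> sets borel"
    unfolding eq by (rule measurable_sets[OF _ assms(1)]) simp
  have "emeasure lebesgue ((*\<^sub>R) c ` A) = ennreal (c ^ DIM('a)) * emeasure lebesgue A"
    using emeasure_lebesgue_affine[of c 0 A] assms(2) by (simp add: image_def ennreal_power)
  with b assms show "emeasure lborel ((*\<^sub>R) c ` A) = ennreal (c ^ DIM('a)) * emeasure lborel A"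
    by simp
qed

text \<open>The multiplicative form becomes the additive one after dilating both sets to the same
  volume: with \<open>t = b / (a + b)\<close> the dilation factors are \<open>(a + b) / a\<close>
  and \<open>(a + b) / b\<close>, and both volumes become \<open>(a + b) ^ DIM('a)\<close>. Volumes
  are given as powers so that no root of a measure has to be taken.\<close>

theorem Brunn_Minkowski:
  fixes A B C :: "'a::euclidean_space set"
  assumes [measurable]: "A \<in> sets borel" "B \<in> sets borel" "C \<in> sets borel"
    and sub: "\<And>x y. x \<in> A \<Longrightarrow> y \<in> B \<Longrightarrow> x + y \<in> C"
    and ab: "0 < a" "0 < b" "emeasure lborel A = ennreal (a ^ DIM('a))" "emeasure lborel B = ennreal (b ^ DIM('a))"
  shows "ennreal ((a + b) ^ DIM('a)) \<le> emeasure lborel C"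
proof -
  define t where "t = b / (a + b)"
  have t: "0 < t" "t < 1" and t1: "1 - t = a / (a + b)" using ab by (auto simp: t_def field_simps)
  define s where "s = (a + b) ^ DIM('a)"
  have s: "s > 0" using ab by (simp add: s_def)
  let ?A = "(*\<^sub>R) (1 / (1-t)) ` A" and ?B = "(*\<^sub>R) (1 / t) ` B"
  have sA: "emeasure lborel ?A = ennreal s"
    using emeasure_lborel_scaleR(2)[OF assms(1), of "1 / (1-t)"] ab
    unfolding t1 s_def by (simp add: power_divide flip: ennreal_mult')
  have sB: "emeasure lborel ?B = ennreal s"
    using emeasure_lborel_scaleR(2)[OF assms(2), of "1 / t"] ab
    unfolding t_def s_def by (simp add: power_divide flip: ennreal_mult')
  have "ennreal (s powr (1-t) * s powr t) \<le> emeasure lborel C"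
  proof (rule Prekopa_Leindler_sets[OF t _ _ _ _ s s])
    show "?A \<in> sets borel" "?B \<in> sets borel"
      using t by (auto intro!: emeasure_lborel_scaleR)
    show "(1-t) *\<^sub>R x + t *\<^sub>R y \<in> C" if "x \<in> ?A" "y \<in> ?B" for x y
      using that t sub by auto
  qed (simp_all add: sA sB)
  also have "s powr (1-t) * s powr t = s" using s by (simp flip: powr_add)
  finally show ?thesis by (simp add: s_def)
qed

section \<open>Saint-Venant and Poincare inequalities\<close>


text \<open>\<open>K\<close> is any compact set outside which \<open>f\<close> and \<open>f'\<close>
  vanish, not necessarily the support; squares, multiples and products can then keep the same
  \<open>K\<close>. The gradient is carried along as an explicit function.\<close>

definition C1_supported :: "'a::euclidean_space set \<Rightarrow> ('a \<Rightarrow> real) \<Rightarrow> ('a \<Rightarrow> 'a) \<Rightarrow> bool" where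
  "C1_supported K f f' \<longleftrightarrow> compact K \<and> (\<forall>x. (f has_derivative (\<lambda>h. f' x \<bullet> h)) (at x)) \<and>
     continuous_on UNIV f' \<and> (\<forall>x. x \<notin> K \<longrightarrow> f x = 0 \<and> f' x = 0)"

lemma C1_supportedD:
  assumes "C1_supported K f f'"
  shows "compact K" "(f has_derivative (\<lambda>h. f' x \<bullet> h)) (at x)" "continuous_on UNIV f'"
    "x \<notin> K \<Longrightarrow> f x = 0" "x \<notin> K \<Longrightarrow> f' x = 0" "continuous_on UNIV f"
    "f \<in> borel_measurable borel" "f' \<in> borel_measurable borel"
proof -
  show 1: "compact K" "(f has_derivative (\<lambda>h. f' x \<bullet> h)) (at x)" "continuous_on UNIV f'"
    "x \<notin> K \<Longrightarrow> f x = 0" "x \<notin> K \<Longrightarrow> f' x = 0" for x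
    using assms by (auto simp: C1_supported_def)
  show 2: "continuous_on UNIV f"
    by (rule has_derivative_continuous_on[OF has_derivative_at_withinI[OF 1(2)]])
  show "f \<in> borel_measurable borel" "f' \<in> borel_measurable borel"
    using 1(3) 2 by (auto intro: borel_measurable_continuous_onI)
qed

lemma C1_supported_scale:
  assumes "C1_supported K f f'"
  shows "C1_supported K (\<lambda>x. c * f x) (\<lambda>x. c *\<^sub>R f' x)"
proof -
  note D = C1_supportedD[OF assms]
  have "((\<lambda>x. c * f x) has_derivative (\<lambda>h. (c *\<^sub>R f' x) \<bullet> h)) (at x)" for x
    by (rule has_derivative_eq_rhs[OF has_derivative_mult_right[OF D(2)]]) (simp add: fun_eq_iff)
  moreover have "continuous_on UNIV (\<lambda>x. c *\<^sub>R f' x)" using D(3) by (intro continuous_intros)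
  ultimately show ?thesis unfolding C1_supported_def using D(1,4,5) by (auto simp del: inner_scaleR_left)
qed

lemma C1_supported_square:
  assumes "C1_supported K f f'"
  shows "C1_supported K (\<lambda>x. (f x)\<^sup>2) (\<lambda>x. (2 * f x) *\<^sub>R f' x)"
proof -
  note D = C1_supportedD[OF assms]
  have "((\<lambda>x. (f x)\<^sup>2) has_derivative (\<lambda>h. ((2 * f x) *\<^sub>R f' x) \<bullet> h)) (at x)" for x
    by (rule has_derivative_eq_rhs[OF has_derivative_power[OF D(2)]]) (simp add: fun_eq_iff)
  moreover have "continuous_on UNIV (\<lambda>x. (2 * f x) *\<^sub>R f' x)" using D(3,6) by (intro continuous_intros)
  ultimately show ?thesis unfolding C1_supported_def using D(1,4,5) by (auto simp del: inner_scaleR_left)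
qed

text \<open>The gradient is uniformly continuous on a ball one unit larger than needed to contain
  \<open>K\<close>. Two points at distance below 1 either both lie in that ball or both lie outside
  \<open>K\<close>, where the gradient is zero; the mean value inequality then gives the expansion
  uniformly on the whole space.\<close>

lemma C1_supported_uniform_expansion:
  fixes f :: "'a::euclidean_space \<Rightarrow> real"
  assumes "C1_supported K f f'" and "e > 0"
  obtains \<delta> where "\<delta> > 0" "\<And>x y. norm (y - x) < \<delta> \<Longrightarrow> \<bar>f y - f x - f' x \<bullet> (y - x)\<bar> \<le> e * norm (y - x)"
proof -
  note D = C1_supportedD[OF assms(1)]
  obtain R where R: "K \<subseteq> cball 0 R"
    using compact_imp_bounded[OF D(1)] by (auto simp: bounded_iff subset_iff)
  have "uniformly_continuous_on (cball 0 (R+1)) f'"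
    by (rule compact_uniformly_continuous[OF continuous_on_subset[OF D(3)]]) auto
  then obtain d where d: "d > 0" "\<And>x y. x \<in> cball 0 (R+1) \<Longrightarrow> y \<in> cball 0 (R+1) \<Longrightarrow> dist y x < d \<Longrightarrow> dist (f' y) (f' x) < e"
    using \<open>e > 0\<close> unfolding uniformly_continuous_on_def by (meson that)
  have uc: "norm (f' y - f' x) \<le> e" if "norm (y - x) < min d 1" for x y
  proof (cases "x \<in> cball 0 (R+1) \<and> y \<in> cball 0 (R+1)")
    case True
    then show ?thesis using d(2)[of x y] that by (auto simp: dist_norm)
  next
    case False
    have "\<bar>norm y - norm x\<bar> < 1" using that norm_triangle_ineq3[of y x] by linarith
    then have "R < norm x" "R < norm y" using False by auto
    then have "x \<notin> K" "y \<notin> K" using R by (auto simp: subset_iff)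
    then show ?thesis using D(5) \<open>e > 0\<close> by simp
  qed
  show ?thesis
  proof
    show "min d 1 > 0" using d by simp
    fix x y :: 'a assume xy: "norm (y - x) < min d 1"
    have "norm (f y - f x - (\<lambda>h. f' x \<bullet> h) (y - x)) \<le> norm (y - x) * e"
    proof (rule differentiable_bound_linearization[where S = "ball x (min d 1)" and f' = "\<lambda>x h. f' x \<bullet> h"])
      show "x + t *\<^sub>R (y - x) \<in> ball x (min d 1)" if "t \<in> {0..1}" for t
      proof -
        have "dist x (x + t *\<^sub>R (y - x)) = t * norm (y - x)" using that by (simp add: dist_norm)
        also have "\<dots> \<le> 1 * norm (y - x)" using that by (intro mult_right_mono) auto
        finally show ?thesis using xy by simp
      qed
      show "(f has_derivative (\<lambda>h. f' z \<bullet> h)) (at z within ball x (min d 1))" for z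
        using D(2) by (rule has_derivative_at_withinI)
      show "onorm ((\<lambda>h. f' z \<bullet> h) - (\<lambda>h. f' x \<bullet> h)) \<le> e" if "z \<in> ball x (min d 1)" for z
      proof (rule onorm_le)
        fix h
        have "norm (((\<lambda>h. f' z \<bullet> h) - (\<lambda>h. f' x \<bullet> h)) h) \<le> norm (f' z - f' x) * norm h"
          using Cauchy_Schwarz_ineq2[of "f' z - f' x" h] by (simp add: inner_diff_left)
        also have "\<dots> \<le> e * norm h"
          using that by (intro mult_right_mono uc) (auto simp: dist_norm norm_minus_commute)
        finally show "norm (((\<lambda>h. f' z \<bullet> h) - (\<lambda>h. f' x \<bullet> h)) h) \<le> e * norm h" .
      qed
      show "x \<in> ball x (min d 1)" using d by simp
    qed
    then show "\<bar>f y - f x - f' x \<bullet> (y - x)\<bar> \<le> e * norm (y - x)" by (simp add: mult.commute)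
  qed
qed

section \<open>Gradient inequalities from sums of subgraphs\<close>

lemma emeasure_subgraph:
  fixes u :: "'a::euclidean_space \<Rightarrow> real"
  assumes [measurable]: "D \<in> sets borel" "u \<in> borel_measurable borel"
  shows "{(x,s). x \<in> D \<and> 0 \<le> s \<and> s \<le> u x} \<in> sets borel" (is "?S \<in> _")
    and "emeasure lborel {(x,s). x \<in> D \<and> 0 \<le> s \<and> s \<le> u x} = (\<integral>\<^sup>+x. indicator D x * ennreal (u x) \<partial>lborel)"
proof -
  have "?S = {p \<in> space (borel \<Otimes>\<^sub>M borel). fst p \<in> D \<and> 0 \<le> snd p \<and> snd p \<le> u (fst p)}"
    by (auto simp: space_pair_measure)
  also have "\<dots> \<in> sets (borel \<Otimes>\<^sub>M borel)" by measurable
  finally show S: "?S \<in> sets borel" unfolding borel_prod .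
  have "?S \<in> sets (lborel \<Otimes>\<^sub>M lborel)" using S unfolding lborel_prod sets_lborel .
  then have "emeasure lborel ?S = (\<integral>\<^sup>+x. emeasure lborel (Pair x -` ?S) \<partial>lborel)"
    by (simp add: lborel.emeasure_pair_measure_alt flip: lborel_prod)
  also have "\<dots> = (\<integral>\<^sup>+x. indicator D x * ennreal (u x) \<partial>lborel)"
  proof (rule nn_integral_cong)
    fix x
    have "Pair x -` ?S = (if x \<in> D then {0..u x} else {})" by auto
    then show "emeasure lborel (Pair x -` ?S) = indicator D x * ennreal (u x)"
      by (cases "0 \<le> u x") (auto simp: indicator_def ennreal_neg)
  qed
  finally show "emeasure lborel ?S = (\<integral>\<^sup>+x. indicator D x * ennreal (u x) \<partial>lborel)" .
qed

text \<open>
  The subgraph of \<open>f\<close> plus a small multiple \<open>t\<close> of the subgraph of \<open>g\<close> lies, up to \<open>o(t)\<close>, below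
  \<open>f\<^sup>+ + t k(|f'|)\<close>; the inequality is the first order term in \<open>t\<close> of the Brunn-Minkowski inequality.
\<close>

lemma Brunn_Minkowski_gradient:
  fixes f :: "'a::euclidean_space \<Rightarrow> real"
  defines "n \<equiv> DIM('a) + 1"
  assumes f: "C1_supported K f f'" "K \<subseteq> \<Omega>" and \<Omega>: "open \<Omega>" "emeasure lborel \<Omega> < \<infinity>"
    and [measurable]: "g \<in> borel_measurable borel" "k \<in> borel_measurable borel"
    and gk: "\<And>v y. norm y \<le> 1 \<Longrightarrow> g y - v \<bullet> y \<le> k (norm v)"
    and k: "\<And>r. 0 \<le> r \<Longrightarrow> 0 \<le> k r"
    and J: "0 < J" "(\<integral>\<^sup>+x. ennreal (f x) \<partial>lborel) = ennreal (J ^ n)"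
    and \<gamma>: "0 < \<gamma>" "(\<integral>\<^sup>+y. indicator (cball 0 1) y * ennreal (g y) \<partial>(lborel :: 'a measure)) = ennreal (\<gamma> ^ n)"
  shows "ennreal (n * J ^ DIM('a) * \<gamma>) \<le> (\<integral>\<^sup>+x. indicator \<Omega> x * ennreal (k (norm (f' x))) \<partial>lborel)" (is "_ \<le> ?W")
proof (cases "?W = \<infinity>")
  case False
  note D = C1_supportedD[OF f(1)]
  note [measurable] = D(7,8)
  have [measurable]: "\<Omega> \<in> sets borel" using \<Omega>(1) by simp
  obtain w where w: "?W = ennreal w" "0 \<le> w" using False by (cases ?W) auto
  obtain m where m: "emeasure lborel \<Omega> = ennreal m" "0 \<le> m" using \<Omega>(2) by (cases "emeasure lborel \<Omega>") auto
  have n: "DIM('a \<times> real) = n" by (simp add: n_def)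
  have main: "n * J ^ DIM('a) * \<gamma> \<le> w + e * m" if e: "e > 0" for e
  proof -
    obtain \<delta> where \<delta>: "\<delta> > 0" "\<And>x y. norm (y - x) < \<delta> \<Longrightarrow> \<bar>f y - f x - f' x \<bullet> (y - x)\<bar> \<le> e * norm (y - x)"
      using C1_supported_uniform_expansion[OF f(1) e] by blast
    obtain r where r: "r > 0" "(\<Union>x\<in>K. cball x r) \<subseteq> \<Omega>"
      using compact_subset_open_imp_cball_epsilon_subset[OF D(1) \<Omega>(1) f(2)] .
    \<comment> \<open>\<open>t \<le> r\<close> keeps the summed subgraph over
      \<open>\<Omega>\<close>, and \<open>t < \<delta>\<close> keeps every displacement within the
      range of the uniform expansion.\<close>
    define t where "t = min \<delta> r / 2"
    have t: "0 < t" "t < \<delta>" "t \<le> r" using \<delta>(1) r(1) by (auto simp: t_def)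
    \<comment> \<open>The positive part appears because subgraphs see only heights
      \<open>s \<ge> 0\<close>; the term \<open>t * e\<close> pays for the expansion error.\<close>
    define u where "u z = max 0 (f z) + t * (k (norm (f' z)) + e)" for z
    have [measurable]: "u \<in> borel_measurable borel" unfolding u_def by measurable
    let ?S = "{(x,s). x \<in> K \<and> 0 \<le> s \<and> s \<le> f x}" and ?G = "{(x,s). x \<in> cball 0 1 \<and> 0 \<le> s \<and> s \<le> g x}"
      and ?C = "{(x,s). x \<in> \<Omega> \<and> 0 \<le> s \<and> s \<le> u x}"
    have [measurable]: "K \<in> sets borel" using D(1) by (simp add: borel_compact)
    have eS: "emeasure lborel ?S = ennreal (J ^ n)"
      unfolding emeasure_subgraph(2)[OF \<open>K \<in> sets borel\<close> D(7)] J(2)[symmetric]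
      by (rule nn_integral_cong) (use D(4) in \<open>auto simp: indicator_def\<close>)
    have "ennreal ((J + t * \<gamma>) ^ DIM('a \<times> real)) \<le> emeasure lborel ?C"
    proof (rule Brunn_Minkowski)
      show "?S \<in> sets borel" "?C \<in> sets borel" "(*\<^sub>R) t ` ?G \<in> sets borel"
        using t by (intro emeasure_subgraph emeasure_lborel_scaleR; simp)+
      show "0 < J" "0 < t * \<gamma>" using J \<gamma> t by auto
      show "emeasure lborel ?S = ennreal (J ^ DIM('a \<times> real))" using eS n by simp
      have "emeasure lborel ((*\<^sub>R) t ` ?G) = ennreal (t ^ n) * emeasure lborel ?G"
        unfolding n[symmetric] using t by (intro emeasure_lborel_scaleR emeasure_subgraph) auto
      also have "emeasure lborel ?G = ennreal (\<gamma> ^ n)"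
        unfolding \<gamma>(2)[symmetric] by (intro emeasure_subgraph) auto
      finally show "emeasure lborel ((*\<^sub>R) t ` ?G) = ennreal ((t * \<gamma>) ^ DIM('a \<times> real))"
        unfolding n using t by (simp add: power_mult_distrib ennreal_mult')
      fix p q assume "p \<in> ?S" "q \<in> (*\<^sub>R) t ` ?G"
      then obtain x s y r' where pq: "p = (x, s)" "x \<in> K" "0 \<le> s" "s \<le> f x"
        "q = (t *\<^sub>R y, t * r')" "norm y \<le> 1" "0 \<le> r'" "r' \<le> g y"
        using t(1) by fastforce
      let ?z = "x + t *\<^sub>R y"
      have nt: "norm (x - ?z) \<le> t" using pq t by (simp add: mult_left_le)
      then have "?z \<in> cball x r" using t unfolding mem_cball dist_norm by linarith
      then have z: "?z \<in> \<Omega>" using r(2) pq(2) by blast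
      \<comment> \<open>The expansion is based at the endpoint \<open>?z\<close>, not at
        \<open>x\<close>: the sum of the two points lies over \<open>?z\<close>, so the bound has to
        involve the gradient there.\<close>
      have "\<bar>f x - f ?z - f' ?z \<bullet> (x - ?z)\<bar> \<le> e * norm (x - ?z)" using nt t(2) by (intro \<delta>(2)) linarith
      also have "\<dots> \<le> e * t" using nt e by (intro mult_left_mono) auto
      finally have "f x \<le> f ?z - t * (f' ?z \<bullet> y) + e * t" by (simp add: inner_diff_right)
      moreover have "t * r' \<le> t * g y" using pq t by (intro mult_left_mono) auto
      moreover have "t * (g y - f' ?z \<bullet> y) \<le> t * k (norm (f' ?z))" using pq t by (intro mult_left_mono gk) auto
      ultimately have "s + t * r' \<le> u ?z"
        using pq unfolding u_def by (simp add: algebra_simps)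
      moreover have "0 \<le> s + t * r'" using pq t by simp
      ultimately show "p + q \<in> ?C" using z pq by simp
    qed
    also have "emeasure lborel ?C = (\<integral>\<^sup>+x. indicator \<Omega> x * ennreal (u x) \<partial>lborel)"
      by (rule emeasure_subgraph) auto
    also have "\<dots> = (\<integral>\<^sup>+x. ennreal (f x) + (ennreal t * (indicator \<Omega> x * ennreal (k (norm (f' x)))) + ennreal (t * e) * indicator \<Omega> x) \<partial>lborel)"
    proof (rule nn_integral_cong)
      fix x
      have "ennreal (max 0 (f x)) = ennreal (f x)" by (simp add: max_def ennreal_neg)
      moreover have "x \<notin> \<Omega> \<Longrightarrow> f x = 0" using D(4)[of x] f(2) by blast
      ultimately show "indicator \<Omega> x * ennreal (u x) = ennreal (f x) + (ennreal t * (indicator \<Omega> x * ennreal (k (norm (f' x)))) + ennreal (t * e) * indicator \<Omega> x)"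
        using t e k[of "norm (f' x)"]
        by (cases "x \<in> \<Omega>") (auto simp: indicator_def u_def distrib_left ennreal_plus ennreal_mult)
    qed
    also have "\<dots> = ennreal (J ^ n) + (ennreal t * ennreal w + ennreal (t * e) * ennreal m)"
      by (simp add: nn_integral_add nn_integral_cmult J w m)
    also have "\<dots> = ennreal (J ^ n + (t * w + t * e * m))"
      using J t e w m by (simp flip: ennreal_mult' ennreal_plus)
    finally have "(J + t * \<gamma>) ^ n \<le> J ^ n + (t * w + t * e * m)"
      unfolding n using J t e w m by (subst (asm) ennreal_le_iff) auto
    \<comment> \<open>Bernoulli supplies the linear term of the \<open>n\<close>-th power;
      \<open>J ^ n\<close> cancels on both sides and \<open>t\<close> divides out.\<close>
    moreover have "J ^ n + n * J ^ DIM('a) * (t * \<gamma>) \<le> (J + t * \<gamma>) ^ n"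
    proof -
      have "0 \<le> t * \<gamma> / J" using t J \<gamma> by simp
      then have "1 + n * (t * \<gamma> / J) \<le> (1 + t * \<gamma> / J) ^ n" by (intro Bernoulli_inequality) simp
      then have "J ^ n * (1 + n * (t * \<gamma> / J)) \<le> J ^ n * (1 + t * \<gamma> / J) ^ n" using J by (intro mult_left_mono) auto
      also have "J ^ n * (1 + t * \<gamma> / J) ^ n = (J + t * \<gamma>) ^ n" using J by (simp add: distrib_left flip: power_mult_distrib)
      also have "J ^ n * (1 + n * (t * \<gamma> / J)) = J ^ n + n * J ^ DIM('a) * (t * \<gamma>)"
        using J by (simp add: n_def distrib_left)
      finally show ?thesis .
    qed
    ultimately have "t * (n * J ^ DIM('a) * \<gamma>) \<le> t * (w + e * m)" by (simp add: algebra_simps)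
    then show ?thesis using t by simp
  qed
  have "n * J ^ DIM('a) * \<gamma> \<le> w"
  proof (rule field_le_epsilon)
    fix e :: real assume "0 < e"
    then have "n * J ^ DIM('a) * \<gamma> \<le> w + e / (m + 1) * m" using m by (intro main) auto
    also have "e / (m + 1) * m \<le> e" using \<open>0 < e\<close> m by (simp add: field_simps)
    finally show "n * J ^ DIM('a) * \<gamma> \<le> w + e" by simp
  qed
  then show ?thesis by (simp add: w ennreal_leI)
qed simp

text \<open>The superlevel set at height \<open>\<mu>\<close> is the ball of radius
  \<open>sqrt (1 - \<mu>)\<close>, of volume \<open>w * (1 - \<mu>) powr (d/2)\<close>; integrating
  over the unit interval gives \<open>w / (d/2 + 1)\<close>.\<close>

lemma nn_integral_paraboloid:
  "(\<integral>\<^sup>+y. indicator (cball 0 1) y * ennreal (1 - (norm y)\<^sup>2) \<partial>(lborel :: 'a::euclidean_space measure))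
    = ennreal (2 * measure lborel (ball (0::'a) 1) / (DIM('a) + 2))"
proof -
  let ?f = "\<lambda>y::'a. indicator (cball 0 1) y * ennreal (1 - (norm y)\<^sup>2)"
  define w where "w = measure lborel (ball (0::'a) 1)"
  have w0: "0 \<le> w" by (simp add: w_def)
  have [measurable]: "(\<lambda>y::'a. 1 - (norm y)\<^sup>2) \<in> borel_measurable borel" "cball (0::'a) 1 \<in> sets borel"
    by (auto intro!: borel_measurable_continuous_onI continuous_intros)
  have [measurable]: "?f \<in> borel_measurable borel" by measurable
  have le1: "min (?f y) (ennreal 1) = ?f y" for y
    by (auto simp: indicator_def min_def ennreal_le_1)
  have lev: "indicator {0..1} \<mu> * emeasure lborel {y. ennreal (1 * \<mu>) < ?f y} = ennreal (indicator {0..1} \<mu> * (w * (1 - \<mu>) powr (DIM('a)/2)))" for \<mu> :: real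
  proof (cases "\<mu> \<in> {0..1}")
    case True
    have "{y. ennreal (1 * \<mu>) < ?f y} = ball 0 (sqrt (1 - \<mu>))"
    proof (intro set_eqI iffI)
      fix y assume "y \<in> {y. ennreal (1 * \<mu>) < ?f y}"
      then have "norm y \<le> 1" "\<mu> < 1 - (norm y)\<^sup>2"
        using True by (cases "norm y \<le> 1"; simp add: ennreal_less_iff)+
      then show "y \<in> ball 0 (sqrt (1 - \<mu>))"
        by (simp add: real_less_rsqrt)
    next
      fix y assume "y \<in> ball (0::'a) (sqrt (1 - \<mu>))"
      then have y: "norm y < sqrt (1 - \<mu>)" by simp
      have "sqrt (1 - \<mu>) \<le> 1" using True by simp
      then have "norm y \<le> 1" using y by linarith
      moreover have "(norm y)\<^sup>2 < (sqrt (1 - \<mu>))\<^sup>2" using y by (intro power_strict_mono) auto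
      ultimately show "y \<in> {y. ennreal (1 * \<mu>) < ?f y}"
        using True y by (auto simp: indicator_def ennreal_less_iff)
    qed
    also have "emeasure lborel (ball (0::'a) (sqrt (1 - \<mu>))) = ennreal (w * (1 - \<mu>) powr (DIM('a)/2))"
    proof -
      have "sqrt (1 - \<mu>) ^ DIM('a) = (1 - \<mu>) powr (DIM('a)/2)"
      proof (cases "\<mu> = 1")
        case False
        then have "sqrt (1 - \<mu>) ^ DIM('a) = ((1 - \<mu>) powr (1/2)) powr DIM('a)"
          using True by (simp add: powr_half_sqrt powr_realpow)
        then show ?thesis by (simp add: powr_powr)
      qed simp
      then show ?thesis using True by (simp add: emeasure_ball w_def content_ball)
    qed
    finally show ?thesis using True by simp
  qed auto
  have "(\<integral>\<^sup>+y. ?f y \<partial>lborel) = (\<integral>\<^sup>+y. min (?f y) (ennreal 1) \<partial>lborel)" by (simp only: le1)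
  also have "\<dots> = ennreal 1 * (\<integral>\<^sup>+\<mu>. indicator {0..1} \<mu> * emeasure lborel {y\<in>space lborel. ennreal (1 * \<mu>) < ?f y} \<partial>lborel)"
    by (rule nn_integral_layer_cake) (auto intro: lborel.sigma_finite_measure_axioms)
  also have "\<dots> = (\<integral>\<^sup>+\<mu>. ennreal (indicator {0..1} \<mu> * (w * (1 - \<mu>) powr (DIM('a)/2))) \<partial>lborel)"
    by (simp add: lev[simplified])
  also have "\<dots> = (\<integral>\<^sup>+\<mu>. ennreal (indicator {0..1} \<mu> * (w * \<mu> powr (DIM('a)/2))) \<partial>lborel)"
    by (subst nn_integral_real_affine[of _ "-1" 1]) (auto simp: indicator_def intro!: nn_integral_cong)
  also have "\<dots> = ennreal (w * (1 powr (DIM('a)/2 + 1) / (DIM('a)/2 + 1)))"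
    using w0 by (intro nn_integral_has_integral_lebesgue has_integral_mult_right has_integral_powr_from_0) auto
  finally show ?thesis by (simp add: w_def field_simps)
qed


text \<open>Optimization over the multiple \<open>l\<close>, followed by clearing the roots: the
  \<open>(d+1)\<close>-st power removes them, and the power \<open>2 / d\<close> then turns
  \<open>(l * I) ^ d\<close> into a square.\<close>

lemma torsion_algebra:
  fixes d :: nat and I A D w :: real
  assumes d: "d > 0" and pos: "I > 0" "A > 0" "D \<ge> 0" "w > 0"
    and hyp: "\<And>l. l > 0 \<Longrightarrow> (d + 1) * root (d+1) (l * I) ^ d * root (d+1) (2 * w / (d + 2)) \<le> A + l\<^sup>2 / 4 * D"
  shows "I\<^sup>2 \<le> A powr ((d + 2) / d) / (d * (d + 2) * w powr (2 / d)) * D"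
proof -
  define C where "C = A powr ((d + 2) / d) / (d * (d + 2) * w powr (2 / d))"
  have C: "C > 0" unfolding C_def using pos d by (intro divide_pos_pos mult_pos_pos) (auto intro: add_pos_pos)
  \<comment> \<open>A strict majorant \<open>E\<close> of \<open>D\<close> keeps \<open>l\<close>
    below well defined when \<open>D = 0\<close>.\<close>
  have main: "I\<^sup>2 \<le> C * E" if E: "E > D" for E
  proof -
    have E0: "E > 0" using E pos by simp
    \<comment> \<open>This \<open>l\<close> makes the quadratic term \<open>d / (d+2)\<close> times
      \<open>A\<close>, its share in the equality case \<open>f = 1 - |x|^2\<close> on the unit
      ball, and so loses nothing.\<close>
    define l where "l = 2 * sqrt (A * d / ((d + 2) * E))"
    have l: "l > 0" using d pos E0 by (simp add: l_def)
    have l2: "l\<^sup>2 = 4 * (A * d / ((d + 2) * E))" using d pos E0 by (simp add: l_def power_mult_distrib)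
    define R where "R = root (d+1) (l * I) ^ d * root (d+1) (2 * w / (d + 2))"
    have R0: "R \<ge> 0" using l pos by (simp add: R_def)
    have "(d + 1) * R \<le> A + l\<^sup>2 / 4 * D" using hyp[OF l] by (simp add: R_def mult.assoc)
    also have "\<dots> \<le> A + l\<^sup>2 / 4 * E" using E by (intro add_left_mono mult_left_mono) auto
    also have "l\<^sup>2 / 4 * E = A * d / (d + 2)" using E0 by (simp add: l2)
    also have "A + A * d / (d + 2) = (d + 1) * (2 * A / (d + 2))" by (simp add: divide_simps) (simp add: algebra_simps)
    finally have "R \<le> 2 * A / (d + 2)" by (simp only: mult_le_cancel_left_pos of_nat_0_less_iff)
    then have "R ^ (d + 1) \<le> (2 * A / (d + 2)) ^ (d + 1)" using R0 by (rule power_mono)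
    moreover have "R ^ (d + 1) = (l * I) ^ d * (2 * w / (d + 2))"
    proof -
      have "(root (d+1) (l * I) ^ d) ^ (d+1) = (root (d+1) (l * I) ^ (d+1)) ^ d"
        by (simp only: flip: power_mult) (simp only: mult.commute)
      moreover have "root (d+1) (l * I) ^ (d+1) = l * I"
        using l pos by (intro real_root_pow_pos2) auto
      moreover have "root (d+1) (2 * w / (d + 2)) ^ (d+1) = 2 * w / (d + 2)"
        using pos by (intro real_root_pow_pos2) auto
      ultimately show ?thesis unfolding R_def by (simp only: power_mult_distrib[of "_ ^ d" "root _ _"])
    qed
    ultimately have "(l * I) ^ d * (2 * w / (d + 2)) \<le> (2 * A / (d + 2)) ^ (d + 1)" by simp
    also have "\<dots> = (2 / (d + 2)) ^ d * A ^ (d + 1) * (2 / (d + 2))"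
      by (simp add: power_mult_distrib power_divide mult_ac)
    finally have "((l * I) ^ d * w) * (2 / (d + 2)) \<le> ((2 / (d + 2)) ^ d * A ^ (d + 1)) * (2 / (d + 2))"
      by (simp add: mult_ac)
    then have 1: "(l * I) ^ d * w \<le> (2 / (d + 2)) ^ d * A ^ (d + 1)"
      by (rule mult_right_le_imp_le) simp
    define X where "X = l * I * ((d + 2) / 2)"
    have X: "X > 0" using l pos by (simp add: X_def)
    have "X ^ d * w = ((l * I) ^ d * w) * ((d + 2) / 2) ^ d" by (simp add: X_def power_mult_distrib power_divide)
    also have "\<dots> \<le> ((2 / (d + 2)) ^ d * A ^ (d + 1)) * ((d + 2) / 2) ^ d"
      using 1 by (intro mult_right_mono) auto
    also have "\<dots> = A ^ (d + 1) * ((2 / (d + 2)) * ((d + 2) / 2)) ^ d"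
      by (simp only: power_mult_distrib mult_ac)
    also have "(2 / (d + 2)) * ((d + 2) / 2) = (1::real)" by simp
    finally have "X ^ d * w \<le> A ^ (d + 1)" by simp
    then have "(X ^ d * w) powr (2 / d) \<le> (A ^ (d + 1)) powr (2 / d)"
      using X pos by (intro powr_mono2) auto
    moreover have "(X ^ d * w) powr (2 / d) = X\<^sup>2 * w powr (2 / d)"
    proof -
      have "(X ^ d) powr (2 / d) = X powr (d * (2 / d))"
        using X by (simp add: powr_powr flip: powr_realpow)
      also have "\<dots> = X\<^sup>2" using X d by (simp add: powr_numeral)
      finally show ?thesis using X pos by (simp add: powr_mult)
    qed
    moreover have "(A ^ (d + 1)) powr (2 / d) = A * A powr ((d + 2) / d)"
    proof -
      have "(A ^ (d + 1)) powr (2 / d) = A powr (real (d + 1) * (2 / d))"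
        using pos by (simp only: powr_powr flip: powr_realpow)
      also have "real (d + 1) * (2 / d) = 1 + (d + 2) / d" using d by (simp add: field_simps)
      finally show ?thesis using pos by (simp only: powr_add powr_one)
    qed
    ultimately have "X\<^sup>2 * w powr (2 / d) \<le> A * A powr ((d + 2) / d)" by simp
    moreover have "X\<^sup>2 = A * (d * (d + 2) * I\<^sup>2 / E)"
    proof -
      have "X\<^sup>2 = l\<^sup>2 * (I\<^sup>2 * ((d + 2) / 2)\<^sup>2)" by (simp only: X_def power_mult_distrib mult_ac)
      moreover have "4 * (A * d / (k * E)) * (I\<^sup>2 * (k / 2)\<^sup>2) = A * (real d * k * I\<^sup>2 / E)" if "k \<noteq> 0" for k :: real
        using that E0 by (simp add: field_simps power2_eq_square)
      from this[of "real (d + 2)"] have "l\<^sup>2 * (I\<^sup>2 * ((d + 2) / 2)\<^sup>2) = A * (d * (d + 2) * I\<^sup>2 / E)"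
        unfolding l2 of_nat_mult of_nat_add of_nat_numeral by (simp del: distrib_left_numeral)
      ultimately show ?thesis by (simp only:)
    qed
    ultimately have "A * (d * (d + 2) * I\<^sup>2 / E * w powr (2 / d)) \<le> A * A powr ((d + 2) / d)"
      by (simp add: mult.assoc)
    then have 2: "d * (d + 2) * I\<^sup>2 / E * w powr (2 / d) \<le> A powr ((d + 2) / d)"
      by (rule mult_left_le_imp_le) (fact pos)
    have "i \<le> B / (c * v) * E" if "c * i / E * v \<le> B" "0 < c" "0 < v" for c i v B :: real
      using that E0 by (simp add: field_simps)
    from this[OF 2] show ?thesis unfolding C_def using d pos by (simp add: add_pos_pos)
  qed
  have "I\<^sup>2 / C \<le> D"
  proof (rule dense_ge)
    fix E assume "D < E"
    then show "I\<^sup>2 / C \<le> E" using main[of E] C by (simp add: field_simps)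
  qed
  then show ?thesis using C unfolding C_def[symmetric] by (simp add: field_simps)
qed

lemma C1_supported_integrable:
  fixes u :: "'a::euclidean_space \<Rightarrow> 'b::euclidean_space"
  assumes "compact K" "continuous_on UNIV u" "\<And>x. x \<notin> K \<Longrightarrow> u x = 0"
  shows "integrable lborel u"
proof -
  have "integrable lborel (\<lambda>x. indicator K x *\<^sub>R u x)"
    by (rule borel_integrable_compact[OF assms(1) continuous_on_subset[OF assms(2)]]) simp
  moreover have "indicator K x *\<^sub>R u x = u x" for x
    using assms(3) by (cases "x \<in> K") auto
  ultimately show ?thesis by simp
qed

text \<open>This is the torsional rigidity of a ball of the same volume:
  \<open>w * R^(d+2) / (d * (d+2))\<close> with \<open>w * R^d\<close> equal to the measure of
  \<open>\<Omega>\<close>.\<close>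

definition saint_venant_const :: "'a::euclidean_space set \<Rightarrow> real" where
  "saint_venant_const \<Omega> = measure lborel \<Omega> powr ((DIM('a) + 2) / DIM('a)) /
     (DIM('a) * (DIM('a) + 2) * measure lborel (ball (0::'a) 1) powr (2 / DIM('a)))"

context
  fixes \<Omega> :: "'a::euclidean_space set"
  assumes \<Omega>: "open \<Omega>" "emeasure lborel \<Omega> < \<infinity>" "0 < measure lborel \<Omega>"
begin

lemma ball1_pos: "0 < measure lborel (ball (0::'a) 1)"
  using content_ball_pos[of 1 "0::'a"] by simp

text \<open>The volume of a subgraph sees only the positive part of \<open>f\<close>. Its integral
  \<open>I\<close> is at least that of \<open>f\<close>, the direction in which the upper bounds are
  used.\<close>

lemma nn_integral_pos_part:
  assumes f: "C1_supported K f f'" and "0 < (LINT x|lborel. f x)"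
  obtains I where "(LINT x|lborel. f x) \<le> I"
    "\<And>l. 0 < l \<Longrightarrow> (\<integral>\<^sup>+x. ennreal (l * f x) \<partial>lborel) = ennreal (l * I)"
proof -
  note D = C1_supportedD[OF f]
  note [measurable] = D(7,8)
  have int: "integrable lborel f" using C1_supported_integrable D(1,4,6) by blast
  then have int': "integrable lborel (\<lambda>x. max 0 (f x))" by simp
  define I where "I = (LINT x|lborel. max 0 (f x))"
  have e: "ennreal (max 0 (f x)) = ennreal (f x)" for x by (simp add: max_def ennreal_neg)
  have I: "(\<integral>\<^sup>+x. ennreal (f x) \<partial>lborel) = ennreal I"
    using nn_integral_eq_integral[OF int'] by (simp add: I_def e)
  show ?thesis
  proof
    show "(LINT x|lborel. f x) \<le> I" unfolding I_def by (intro integral_mono int int') simp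
    show "(\<integral>\<^sup>+x. ennreal (l * f x) \<partial>lborel) = ennreal (l * I)" if "0 < l" for l
      using that by (simp add: ennreal_mult' nn_integral_cmult I)
  qed
qed

lemma emeasure_\<Omega>: "emeasure lborel \<Omega> = ennreal (measure lborel \<Omega>)"
  using \<Omega>(2) by (simp add: emeasure_eq_ennreal_measure)

lemma Saint_Venant_pos:
  assumes f: "C1_supported K f f'" "K \<subseteq> \<Omega>" and pos: "0 < (LINT x|lborel. f x)"
  shows "(LINT x|lborel. f x)\<^sup>2 \<le> saint_venant_const \<Omega> * (LINT x|lborel. (norm (f' x))\<^sup>2)"
proof -
  note D = C1_supportedD[OF f(1)]
  note [measurable] = D(7,8)
  obtain I where I: "(LINT x|lborel. f x) \<le> I"
    "\<And>l. 0 < l \<Longrightarrow> (\<integral>\<^sup>+x. ennreal (l * f x) \<partial>lborel) = ennreal (l * I)"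
    using nn_integral_pos_part[OF f(1) pos] by blast
  define w where "w = measure lborel (ball (0::'a) 1)"
  have w: "w > 0" using ball1_pos by (simp add: w_def)
  have I0: "I > 0" using I pos by simp
  have [measurable]: "\<Omega> \<in> sets borel" using \<Omega> by simp
  have intD: "integrable lborel (\<lambda>x. (norm (f' x))\<^sup>2)"
    using D(1,3,5) by (intro C1_supported_integrable[of K]) (auto intro!: continuous_intros)
  have "I\<^sup>2 \<le> saint_venant_const \<Omega> * (LINT x|lborel. (norm (f' x))\<^sup>2)"
    unfolding saint_venant_const_def w_def[symmetric]
  proof (rule torsion_algebra)
    show "DIM('a) > 0" "I > 0" "w > 0" "measure lborel \<Omega> > 0" by (fact DIM_positive I0 w \<Omega>)+
    show "0 \<le> (LINT x|lborel. (norm (f' x))\<^sup>2)" by simp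
    fix l :: real assume l: "l > 0"
    have "ennreal (real (DIM('a) + 1) * root (DIM('a) + 1) (l * I) ^ DIM('a) * root (DIM('a) + 1) (2 * w / (DIM('a) + 2)))
      \<le> (\<integral>\<^sup>+x. indicator \<Omega> x * ennreal (1 + (norm (l *\<^sub>R f' x))\<^sup>2 / 4) \<partial>lborel)"
    proof (rule Brunn_Minkowski_gradient[OF C1_supported_scale[OF f(1)] f(2) \<Omega>(1,2),
          where g = "\<lambda>y. 1 - (norm y)\<^sup>2" and k = "\<lambda>r. 1 + r\<^sup>2 / 4"])
      \<comment> \<open>The convex conjugate of the paraboloid, bounded by completing the square in
        \<open>norm v / 2 - norm y\<close>.\<close>
      show "1 - (norm y)\<^sup>2 - v \<bullet> y \<le> 1 + (norm v)\<^sup>2 / 4" for v y :: 'a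
        using Cauchy_Schwarz_ineq2[of v y] zero_le_power2[of "norm v / 2 - norm y"]
        by (simp add: power2_diff power_divide)
      show "(\<integral>\<^sup>+x. ennreal (l * f x) \<partial>lborel) = ennreal (root (DIM('a) + 1) (l * I) ^ (DIM('a) + 1))"
        using I(2)[OF l] l I0 by (subst real_root_pow_pos2) auto
      show "(\<integral>\<^sup>+y. indicator (cball 0 1) y * ennreal (1 - (norm y)\<^sup>2) \<partial>(lborel :: 'a measure)) =
         ennreal (root (DIM('a) + 1) (2 * w / (DIM('a) + 2)) ^ (DIM('a) + 1))"
        using nn_integral_paraboloid[where 'a='a] w by (subst real_root_pow_pos2) (auto simp: w_def add.commute)
      show "(\<lambda>y::'a. 1 - (norm y)\<^sup>2) \<in> borel_measurable borel"
        by (intro borel_measurable_continuous_onI continuous_intros)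
    qed (use l I0 w in auto)
    also have "\<dots> = (\<integral>\<^sup>+x. indicator \<Omega> x + ennreal (l\<^sup>2 / 4) * ennreal ((norm (f' x))\<^sup>2) \<partial>lborel)"
    proof (rule nn_integral_cong)
      fix x
      show "indicator \<Omega> x * ennreal (1 + (norm (l *\<^sub>R f' x))\<^sup>2 / 4) = indicator \<Omega> x + ennreal (l\<^sup>2 / 4) * ennreal ((norm (f' x))\<^sup>2)"
      proof (cases "x \<in> \<Omega>")
        case True
        then show ?thesis by (simp add: ennreal_plus power_mult_distrib flip: ennreal_mult')
      next
        case False
        then have "f' x = 0" using D(5) f(2) by blast
        then show ?thesis using False by simp
      qed
    qed
    also have "\<dots> = emeasure lborel \<Omega> + ennreal (l\<^sup>2 / 4) * (\<integral>\<^sup>+x. ennreal ((norm (f' x))\<^sup>2) \<partial>lborel)"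
      by (simp add: nn_integral_add nn_integral_cmult)
    also have "(\<integral>\<^sup>+x. ennreal ((norm (f' x))\<^sup>2) \<partial>lborel) = ennreal (LINT x|lborel. (norm (f' x))\<^sup>2)"
      using nn_integral_eq_integral[OF intD] by simp
    also have "emeasure lborel \<Omega> + ennreal (l\<^sup>2 / 4) * ennreal (LINT x|lborel. (norm (f' x))\<^sup>2)
       = ennreal (measure lborel \<Omega> + l\<^sup>2 / 4 * (LINT x|lborel. (norm (f' x))\<^sup>2))"
      unfolding emeasure_\<Omega> by (subst ennreal_mult'[symmetric], simp, rule ennreal_plus[symmetric]) auto
    finally show "(DIM('a) + 1) * root (DIM('a) + 1) (l * I) ^ DIM('a) * root (DIM('a) + 1) (2 * w / (DIM('a) + 2)) \<le>
        measure lborel \<Omega> + l\<^sup>2 / 4 * (LINT x|lborel. (norm (f' x))\<^sup>2)"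
      by (subst (asm) ennreal_le_iff) auto
  qed
  moreover have "(LINT x|lborel. f x)\<^sup>2 \<le> I\<^sup>2" using I(1) pos by (intro power_mono) auto
  ultimately show ?thesis by simp
qed

lemma Saint_Venant_C1:
  assumes f: "C1_supported K f f'" "K \<subseteq> \<Omega>"
  shows "(LINT x|lborel. f x)\<^sup>2 \<le> saint_venant_const \<Omega> * (LINT x|lborel. (norm (f' x))\<^sup>2)"
proof -
  consider "(LINT x|lborel. f x) = 0" | "0 < (LINT x|lborel. f x)" | "0 < (LINT x|lborel. (-1) * f x)"
    by fastforce
  then show ?thesis
  proof cases
    case 1
    then show ?thesis by (simp add: saint_venant_const_def)
  next
    case 2
    then show ?thesis using Saint_Venant_pos f by blast
  next
    case 3
    then show ?thesis using Saint_Venant_pos[OF C1_supported_scale[OF f(1), of "-1"] f(2)] by simp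
  qed
qed

text \<open>For the cylinder \<open>g = 1\<close> over the unit ball the conjugate is
  \<open>1 + r\<close>, linear in the gradient. Only some constant is needed, so the choices below
  are crude.\<close>

lemma L1_gradient_bound:
  obtains c where "0 < c" "\<And>K f f'. C1_supported K f f' \<Longrightarrow> K \<subseteq> \<Omega> \<Longrightarrow>
      (LINT x|lborel. f x) \<le> c * (LINT x|lborel. norm (f' x))"
proof
  define A where "A = measure lborel \<Omega>"
  have A: "A > 0" using \<Omega> by (simp add: A_def)
  define n where "n = DIM('a) + 1"
  define w where "w = measure lborel (ball (0::'a) 1)"
  have w: "w > 0" using ball1_pos by (simp add: w_def)
  define \<gamma> where "\<gamma> = root n w"
  have \<gamma>: "\<gamma> > 0" "\<gamma> ^ n = w" using w by (simp_all add: \<gamma>_def n_def real_root_pow_pos2 del: power_Suc)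
  \<comment> \<open>The maximum with 1 avoids a \<open>d\<close>-th root: either
    \<open>r \<le> 1\<close>, or \<open>r \<le> r ^ d\<close>, so a bound on \<open>r ^ d\<close>
    bounds \<open>r\<close> itself.\<close>
  define B where "B = max 1 (2 * A / (n * \<gamma>))"
  define c where "c = B ^ n / A"
  have B: "B \<ge> 1" by (simp add: B_def)
  show c: "0 < c" using A B by (simp add: c_def)
  fix K f f' assume f: "C1_supported K f f'" "K \<subseteq> \<Omega>"
  note D = C1_supportedD[OF f(1)]
  note [measurable] = D(7,8)
  have [measurable]: "\<Omega> \<in> sets borel" using \<Omega> by simp
  define L where "L = (LINT x|lborel. norm (f' x))"
  have L: "L \<ge> 0" by (simp add: L_def)
  have intD: "integrable lborel (\<lambda>x. norm (f' x))"
    using D(1,3,5) by (intro C1_supported_integrable[of K]) (auto intro!: continuous_intros)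
  show "(LINT x|lborel. f x) \<le> c * (LINT x|lborel. norm (f' x))"
  proof (cases "0 < (LINT x|lborel. f x)")
    case True
    obtain I where I: "(LINT x|lborel. f x) \<le> I"
      "\<And>l. 0 < l \<Longrightarrow> (\<integral>\<^sup>+x. ennreal (l * f x) \<partial>lborel) = ennreal (l * I)"
      using nn_integral_pos_part[OF f(1) True] by blast
    have I0: "I > 0" using I True by simp
    have "I / c \<le> L"
    proof (rule dense_ge)
      fix M assume M: "L < M"
      then have M0: "M > 0" using L by simp
      \<comment> \<open>Chosen so that the gradient term \<open>l * L\<close> does not exceed the
        volume term \<open>A\<close>; using \<open>M > L\<close> in place of \<open>L\<close> avoids
        division by zero.\<close>
      define l where "l = A / M"
      have l: "l > 0" using A M0 by (simp add: l_def)
      define r where "r = root n (l * I)"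
      have r: "r > 0" "r ^ n = l * I" using l I0 by (simp_all add: r_def n_def real_root_pow_pos2 del: power_Suc)
      have "ennreal (real (DIM('a) + 1) * r ^ DIM('a) * \<gamma>) \<le> (\<integral>\<^sup>+x. indicator \<Omega> x * ennreal (1 + norm (l *\<^sub>R f' x)) \<partial>lborel)"
      proof (rule Brunn_Minkowski_gradient[OF C1_supported_scale[OF f(1)] f(2) \<Omega>(1,2),
            where g = "\<lambda>y. 1" and k = "\<lambda>r. 1 + r"])
        show "1 - v \<bullet> y \<le> 1 + norm v" if "norm y \<le> 1" for v y :: 'a
        proof -
          have "\<bar>v \<bullet> y\<bar> \<le> norm v * norm y" by (rule Cauchy_Schwarz_ineq2)
          also have "\<dots> \<le> norm v" using that by (simp add: mult_left_le)
          finally show ?thesis by linarith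
        qed
        show "(\<integral>\<^sup>+x. ennreal (l * f x) \<partial>lborel) = ennreal (r ^ (DIM('a) + 1))"
          using I(2)[OF l] r n_def by simp
        show "(\<integral>\<^sup>+y. indicator (cball 0 1) y * ennreal 1 \<partial>(lborel :: 'a measure)) = ennreal (\<gamma> ^ (DIM('a) + 1))"
          using \<gamma>(2) unfolding n_def w_def by (simp add: emeasure_cball content_ball)
      qed (use r \<gamma> in auto)
      also have "\<dots> = (\<integral>\<^sup>+x. indicator \<Omega> x + ennreal l * ennreal (norm (f' x)) \<partial>lborel)"
      proof (rule nn_integral_cong)
        fix x
        show "indicator \<Omega> x * ennreal (1 + norm (l *\<^sub>R f' x)) = indicator \<Omega> x + ennreal l * ennreal (norm (f' x))"
        proof (cases "x \<in> \<Omega>")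
          case True
          then show ?thesis using l by (simp add: ennreal_plus flip: ennreal_mult')
        next
          case False
          then have "f' x = 0" using D(5) f(2) by blast
          then show ?thesis using False by simp
        qed
      qed
      also have "\<dots> = emeasure lborel \<Omega> + ennreal l * (\<integral>\<^sup>+x. ennreal (norm (f' x)) \<partial>lborel)"
        by (simp add: nn_integral_add nn_integral_cmult)
      also have "(\<integral>\<^sup>+x. ennreal (norm (f' x)) \<partial>lborel) = ennreal L"
        using nn_integral_eq_integral[OF intD] by (simp add: L_def)
      also have "emeasure lborel \<Omega> + ennreal l * ennreal L = ennreal (A + l * L)"
        using L l A by (subst ennreal_plus) (simp_all add: emeasure_\<Omega> ennreal_mult' A_def)
      finally have "n * r ^ DIM('a) * \<gamma> \<le> A + l * L"
        using A L l unfolding n_def by (subst (asm) ennreal_le_iff) auto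
      also have "l * L \<le> l * M" using M l by (intro mult_left_mono) auto
      also have "A + l * M = 2 * A" using M0 by (simp add: l_def)
      finally have "r ^ DIM('a) \<le> 2 * A / (n * \<gamma>)"
        using \<gamma>(1) by (subst pos_le_divide_eq) (auto simp: n_def mult_ac)
      then have rd: "r ^ DIM('a) \<le> B" by (simp add: B_def)
      have "r \<le> B"
      proof (cases "r \<le> 1")
        case False
        then have "r ^ 1 \<le> r ^ DIM('a)" by (intro power_increasing) (auto simp: Suc_leI)
        then show ?thesis using rd by simp
      qed (use B in simp)
      then have "l * I \<le> B ^ n" unfolding r(2)[symmetric] using r by (intro power_mono) auto
      then show "I / c \<le> M" using A M0 c B by (simp add: l_def c_def field_simps)
    qed
    then show ?thesis using c I(1) unfolding L_def[symmetric] by (simp add: field_simps)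
  next
    case False
    then show ?thesis using c L unfolding L_def by (smt (verit) mult_nonneg_nonneg)
  qed
qed

lemma Poincare_C1:
  obtains c where "0 < c" "\<And>K f f'. C1_supported K f f' \<Longrightarrow> K \<subseteq> \<Omega> \<Longrightarrow>
      (LINT x|lborel. (f x)\<^sup>2) \<le> c * (LINT x|lborel. (norm (f' x))\<^sup>2)"
proof -
  obtain c where c: "0 < c" "\<And>K f f'. C1_supported K f f' \<Longrightarrow> K \<subseteq> \<Omega> \<Longrightarrow>
      (LINT x|lborel. f x) \<le> c * (LINT x|lborel. norm (f' x))"
    using L1_gradient_bound by metis
  show ?thesis
  proof
    show "0 < 4 * c\<^sup>2" using c by simp
    fix K f f' assume f: "C1_supported K f f'" "K \<subseteq> \<Omega>"
    note D = C1_supportedD[OF f(1)]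
    have int: "integrable lborel (\<lambda>x. (f x)\<^sup>2)" "integrable lborel (\<lambda>x. (norm (f' x))\<^sup>2)"
      "integrable lborel (\<lambda>x. norm ((2 * f x) *\<^sub>R f' x))"
      using D(1,3-6) by (intro C1_supported_integrable[of K]; auto intro!: continuous_intros)+
    have "(LINT x|lborel. (f x)\<^sup>2) \<le> c * (LINT x|lborel. norm ((2 * f x) *\<^sub>R f' x))"
      using c(2)[OF C1_supported_square[OF f(1)] f(2)] .
    also have "\<dots> = (LINT x|lborel. c * norm ((2 * f x) *\<^sub>R f' x))" by simp
    \<comment> \<open>Young's inequality weighted to leave half of the integral of the square, which
      is finite and can be moved to the left.\<close>
    also have "\<dots> \<le> (LINT x|lborel. (f x)\<^sup>2 / 2 + 2 * c\<^sup>2 * (norm (f' x))\<^sup>2)"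
    proof (rule integral_mono)
      fix x
      show "c * norm ((2 * f x) *\<^sub>R f' x) \<le> (f x)\<^sup>2 / 2 + 2 * c\<^sup>2 * (norm (f' x))\<^sup>2"
        using zero_le_power2[of "\<bar>f x\<bar> - 2 * c * norm (f' x)"]
        by (simp add: power2_diff power_mult_distrib abs_mult algebra_simps)
    qed (use int in auto)
    also have "\<dots> = (LINT x|lborel. (f x)\<^sup>2) / 2 + 2 * c\<^sup>2 * (LINT x|lborel. (norm (f' x))\<^sup>2)"
      using int by simp
    finally show "(LINT x|lborel. (f x)\<^sup>2) \<le> 4 * c\<^sup>2 * (LINT x|lborel. (norm (f' x))\<^sup>2)" by simp
  qed
qed

end

section \<open>The space \<open>L\<^sup>2\<close>\<close>


abbreviation sq_norm :: "'a::euclidean_space set \<Rightarrow> ('a \<Rightarrow> 'b::euclidean_space) \<Rightarrow> real" where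
  "sq_norm \<Omega> f \<equiv> LINT x|lebesgue_on \<Omega>. (norm (f x))\<^sup>2"

lemma L2D:
  assumes "f \<in> L2 \<Omega>"
  shows "f \<in> borel_measurable (lebesgue_on \<Omega>)" "integrable (lebesgue_on \<Omega>) (\<lambda>x. (norm (f x))\<^sup>2)"
  using assms by (auto simp: L2_def)

lemma integrable_norm_mult_L2:
  assumes "f \<in> L2 \<Omega>" "g \<in> L2 \<Omega>"
  shows "integrable (lebesgue_on \<Omega>) (\<lambda>x. norm (f x) * norm (g x))"
proof -
  note [measurable] = L2D(1)[OF assms(1)] L2D(1)[OF assms(2)]
  have int: "integrable (lebesgue_on \<Omega>) (\<lambda>x. (norm (f x))\<^sup>2 + (norm (g x))\<^sup>2)"
    using assms by (intro Bochner_Integration.integrable_add L2D(2))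
  have b: "norm (f x) * norm (g x) \<le> (norm (f x))\<^sup>2 + (norm (g x))\<^sup>2" for x
    using sum_squares_bound[of "norm (f x)" "norm (g x)"] mult_nonneg_nonneg[OF norm_ge_zero norm_ge_zero, of "f x" "g x"]
    by linarith
  show ?thesis
    by (rule Bochner_Integration.integrable_bound[OF int]) (use b in auto)
qed

lemma integrable_inner_L2:
  assumes "f \<in> L2 \<Omega>" "g \<in> L2 \<Omega>"
  shows "integrable (lebesgue_on \<Omega>) (\<lambda>x. f x \<bullet> g x)"
proof -
  note [measurable] = L2D(1)[OF assms(1)] L2D(1)[OF assms(2)]
  show ?thesis
    by (rule Bochner_Integration.integrable_bound[OF integrable_norm_mult_L2[OF assms]])
      (auto simp: Cauchy_Schwarz_ineq2)
qed

lemma L2_combination: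
  fixes f g :: "'a::euclidean_space \<Rightarrow> 'b::euclidean_space"
  assumes "f \<in> L2 \<Omega>" "g \<in> L2 \<Omega>"
  shows "(\<lambda>x. f x + c *\<^sub>R g x) \<in> L2 \<Omega>"
    and "sq_norm \<Omega> (\<lambda>x. f x + c *\<^sub>R g x) =
      sq_norm \<Omega> f + 2 * c * (LINT x|lebesgue_on \<Omega>. f x \<bullet> g x) + c\<^sup>2 * sq_norm \<Omega> g"
proof -
  note [measurable] = L2D(1)[OF assms(1)] L2D(1)[OF assms(2)]
  note int = L2D(2)[OF assms(1)] L2D(2)[OF assms(2)] integrable_inner_L2[OF assms]
  have eq: "(norm (f x + c *\<^sub>R g x))\<^sup>2 = (norm (f x))\<^sup>2 + 2 * c * (f x \<bullet> g x) + c\<^sup>2 * (norm (g x))\<^sup>2" for x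
    unfolding power2_norm_eq_inner by (simp add: inner_add_left inner_add_right inner_commute power2_eq_square algebra_simps)
  show "(\<lambda>x. f x + c *\<^sub>R g x) \<in> L2 \<Omega>" using int by (simp add: L2_def eq)
  show "sq_norm \<Omega> (\<lambda>x. f x + c *\<^sub>R g x) =
      sq_norm \<Omega> f + 2 * c * (LINT x|lebesgue_on \<Omega>. f x \<bullet> g x) + c\<^sup>2 * sq_norm \<Omega> g"
    unfolding eq using int by simp
qed

lemma L2_diff:
  fixes f g :: "'a::euclidean_space \<Rightarrow> 'b::euclidean_space"
  assumes "f \<in> L2 \<Omega>" "g \<in> L2 \<Omega>"
  shows "(\<lambda>x. f x - g x) \<in> L2 \<Omega>"
  using L2_combination(1)[OF assms, of "-1"] by simp

lemma Cauchy_Schwarz_L2_norm: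
  assumes f: "f \<in> L2 \<Omega>" and g: "g \<in> L2 \<Omega>"
  shows "(LINT x|lebesgue_on \<Omega>. norm (f x) * norm (g x))\<^sup>2 \<le> sq_norm \<Omega> f * sq_norm \<Omega> g"
proof -
  note [measurable] = L2D(1)[OF f] L2D(1)[OF g]
  let ?N = "LINT x|lebesgue_on \<Omega>. norm (f x) * norm (g x)"
  have "ennreal (?N\<^sup>2) = (\<integral>\<^sup>+x. ennreal (norm (f x)) * ennreal (norm (g x)) \<partial>lebesgue_on \<Omega>)\<^sup>2"
    using nn_integral_eq_integral[OF integrable_norm_mult_L2[OF f g]]
    by (simp add: ennreal_mult' ennreal_power)
  also have "\<dots> \<le> (\<integral>\<^sup>+x. (ennreal (norm (f x)))\<^sup>2 \<partial>lebesgue_on \<Omega>) * (\<integral>\<^sup>+x. (ennreal (norm (g x)))\<^sup>2 \<partial>lebesgue_on \<Omega>)"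
    by (rule Cauchy_Schwarz_nn_integral) auto
  also have "\<dots> = ennreal (sq_norm \<Omega> f * sq_norm \<Omega> g)"
    using nn_integral_eq_integral[OF L2D(2)[OF f]] nn_integral_eq_integral[OF L2D(2)[OF g]]
    by (simp add: ennreal_power ennreal_mult')
  finally show ?thesis by (subst (asm) ennreal_le_iff) auto
qed

lemma Cauchy_Schwarz_L2:
  assumes f: "f \<in> L2 \<Omega>" and g: "g \<in> L2 \<Omega>"
  shows "(LINT x|lebesgue_on \<Omega>. f x \<bullet> g x)\<^sup>2 \<le> sq_norm \<Omega> f * sq_norm \<Omega> g"
proof -
  have "\<bar>LINT x|lebesgue_on \<Omega>. f x \<bullet> g x\<bar> \<le> (LINT x|lebesgue_on \<Omega>. norm (f x) * norm (g x))"
    by (rule integral_abs_bound_integral[OF integrable_inner_L2[OF f g] integrable_norm_mult_L2[OF f g]]) (rule Cauchy_Schwarz_ineq2)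
  then have "(LINT x|lebesgue_on \<Omega>. f x \<bullet> g x)\<^sup>2 \<le> (LINT x|lebesgue_on \<Omega>. norm (f x) * norm (g x))\<^sup>2"
    by (simp add: abs_le_square_iff[symmetric])
  then show ?thesis using Cauchy_Schwarz_L2_norm[OF f g] by linarith
qed

text \<open>Membership in \<open>L2\<close> is part of the notion because the Lebesgue integral of a
  non-integrable function is 0 by convention, so a vanishing limit of the integrals alone would not
  express convergence.\<close>

definition L2_tendsto :: "'a::euclidean_space set \<Rightarrow> (nat \<Rightarrow> 'a \<Rightarrow> 'b::euclidean_space) \<Rightarrow> ('a \<Rightarrow> 'b) \<Rightarrow> bool" where
  "L2_tendsto \<Omega> s f \<longleftrightarrow> f \<in> L2 \<Omega> \<and> (\<forall>n. s n \<in> L2 \<Omega>) \<and> (\<lambda>n. sq_norm \<Omega> (\<lambda>x. f x - s n x)) \<longlonglongrightarrow> 0"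

lemma L2_tendsto_const: "f \<in> L2 \<Omega> \<Longrightarrow> L2_tendsto \<Omega> (\<lambda>_. f) f"
  by (simp add: L2_tendsto_def)

lemma tendsto_0_of_square_le:
  fixes a b :: "nat \<Rightarrow> real"
  assumes "b \<longlonglongrightarrow> 0" "\<And>n. (a n)\<^sup>2 \<le> b n"
  shows "a \<longlonglongrightarrow> 0"
proof (rule tendsto_rabs_zero_cancel, rule tendsto_sandwich[of "\<lambda>_. 0"])
  show "(\<lambda>n. sqrt (b n)) \<longlonglongrightarrow> 0" using tendsto_real_sqrt[OF assms(1)] by simp
  show "\<forall>\<^sub>F n in sequentially. \<bar>a n\<bar> \<le> sqrt (b n)"
    using assms(2) by (auto intro!: always_eventually real_le_rsqrt)
qed auto

text \<open>Expanding around the limits leaves three error terms, each containing a difference that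
  tends to zero in norm; Cauchy-Schwarz handles each of them.\<close>

lemma tendsto_inner_L2:
  assumes s: "L2_tendsto \<Omega> s f" and r: "L2_tendsto \<Omega> r g"
  shows "(\<lambda>n. LINT x|lebesgue_on \<Omega>. s n x \<bullet> r n x) \<longlonglongrightarrow> (LINT x|lebesgue_on \<Omega>. f x \<bullet> g x)"
proof -
  have L: "f \<in> L2 \<Omega>" "g \<in> L2 \<Omega>" "s n \<in> L2 \<Omega>" "r n \<in> L2 \<Omega>" for n
    using s r by (auto simp: L2_tendsto_def)
  note Ld = L2_diff[OF L(1,3)] L2_diff[OF L(2,4)]
  have lim: "(\<lambda>n. sq_norm \<Omega> (\<lambda>x. f x - s n x)) \<longlonglongrightarrow> 0" "(\<lambda>n. sq_norm \<Omega> (\<lambda>x. g x - r n x)) \<longlonglongrightarrow> 0"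
    using s r by (auto simp: L2_tendsto_def)
  have 1: "(\<lambda>n. LINT x|lebesgue_on \<Omega>. (f x - s n x) \<bullet> (g x - r n x)) \<longlonglongrightarrow> 0"
    by (rule tendsto_0_of_square_le[OF _ Cauchy_Schwarz_L2[OF Ld]])
      (rule tendsto_mult_zero[OF lim])
  have 2: "(\<lambda>n. LINT x|lebesgue_on \<Omega>. (f x - s n x) \<bullet> g x) \<longlonglongrightarrow> 0"
    by (rule tendsto_0_of_square_le[OF _ Cauchy_Schwarz_L2[OF Ld(1) L(2)]])
      (rule tendsto_mult_left_zero[OF lim(1)])
  have 3: "(\<lambda>n. LINT x|lebesgue_on \<Omega>. f x \<bullet> (g x - r n x)) \<longlonglongrightarrow> 0"
    by (rule tendsto_0_of_square_le[OF _ Cauchy_Schwarz_L2[OF L(1) Ld(2)]])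
      (rule tendsto_mult_right_zero[OF lim(2)])
  have eq: "(LINT x|lebesgue_on \<Omega>. s n x \<bullet> r n x) = (LINT x|lebesgue_on \<Omega>. f x \<bullet> g x)
      + (LINT x|lebesgue_on \<Omega>. (f x - s n x) \<bullet> (g x - r n x)) - (LINT x|lebesgue_on \<Omega>. (f x - s n x) \<bullet> g x)
      - (LINT x|lebesgue_on \<Omega>. f x \<bullet> (g x - r n x))" for n
  proof -
    have "(LINT x|lebesgue_on \<Omega>. s n x \<bullet> r n x) = (LINT x|lebesgue_on \<Omega>. f x \<bullet> g x
      + (f x - s n x) \<bullet> (g x - r n x) - (f x - s n x) \<bullet> g x - f x \<bullet> (g x - r n x))"
      by (rule Bochner_Integration.integral_cong) (auto simp: inner_diff_left inner_diff_right)
    also have "\<dots> = (LINT x|lebesgue_on \<Omega>. f x \<bullet> g x)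
      + (LINT x|lebesgue_on \<Omega>. (f x - s n x) \<bullet> (g x - r n x)) - (LINT x|lebesgue_on \<Omega>. (f x - s n x) \<bullet> g x)
      - (LINT x|lebesgue_on \<Omega>. f x \<bullet> (g x - r n x))"
      using L Ld by (simp add: integrable_inner_L2)
    finally show ?thesis .
  qed
  show ?thesis
    unfolding eq using tendsto_diff[OF tendsto_diff[OF tendsto_add[OF tendsto_const 1] 2] 3] by simp
qed

lemma tendsto_sq_norm_L2:
  assumes "L2_tendsto \<Omega> s f"
  shows "(\<lambda>n. sq_norm \<Omega> (s n)) \<longlonglongrightarrow> sq_norm \<Omega> f"
  using tendsto_inner_L2[OF assms assms] by (simp add: power2_norm_eq_inner)

context
  fixes \<Omega> :: "'a::euclidean_space set"
  assumes fin: "\<Omega> \<in> lmeasurable"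
begin

lemma L2_const: "(\<lambda>_. c) \<in> L2 \<Omega>"
proof -
  interpret finite_measure "lebesgue_on \<Omega>" by (rule finite_measure_lebesgue_on[OF fin])
  show ?thesis by (simp add: L2_def)
qed

lemma integrable_L2:
  assumes f: "f \<in> L2 \<Omega>"
  shows "integrable (lebesgue_on \<Omega>) f"
  by (rule integrable_norm_cancel[OF _ L2D(1)[OF f]])
    (use integrable_norm_mult_L2[OF f L2_const[of "1::real"]] in simp)

lemma measure_lebesgue_on_space: "sq_norm \<Omega> (\<lambda>_. 1::real) = measure lebesgue \<Omega>"
  using fin by (simp add: measure_restrict_space)

lemma integral_norm_L2_bound:
  assumes "f \<in> L2 \<Omega>"
  shows "(LINT x|lebesgue_on \<Omega>. norm (f x))\<^sup>2 \<le> sq_norm \<Omega> f * measure lebesgue \<Omega>"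
  using Cauchy_Schwarz_L2_norm[OF assms L2_const[of "1::real"]] unfolding measure_lebesgue_on_space by simp

lemma tendsto_integral_L2:
  assumes "L2_tendsto \<Omega> s (f :: 'a \<Rightarrow> real)"
  shows "(\<lambda>n. LINT x|lebesgue_on \<Omega>. s n x) \<longlonglongrightarrow> (LINT x|lebesgue_on \<Omega>. f x)"
  using tendsto_inner_L2[OF assms L2_tendsto_const[OF L2_const[of "1::real"]]] by simp

text \<open>On a set of finite measure an L2 Cauchy sequence is L1 Cauchy, so a subsequence
  converges almost everywhere. Fatou along this subsequence then bounds the L2 distance of every
  late term to the limit.\<close>

lemma L2_complete:
  fixes s :: "nat \<Rightarrow> 'a \<Rightarrow> 'b::euclidean_space"
  assumes s: "\<And>n. s n \<in> L2 \<Omega>"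
    and Cauchy: "\<And>e. e > 0 \<Longrightarrow> \<exists>N. \<forall>i\<ge>N. \<forall>j\<ge>N. sq_norm \<Omega> (\<lambda>x. s i x - s j x) < e"
  obtains f where "L2_tendsto \<Omega> s f"
proof -
  let ?M = "lebesgue_on \<Omega>"
  note [measurable] = L2D(1)[OF s]
  define A where "A = measure lebesgue \<Omega> + 1"
  have A: "A > 0" by (simp add: A_def add_nonneg_pos)
  have "\<exists>N. \<forall>i\<ge>N. \<forall>j\<ge>N. (LINT x|?M. norm (s i x - s j x)) < e" if e: "e > 0" for e
  proof -
    have "e\<^sup>2 / A > 0" using e A by simp
    then obtain N where N: "\<And>i j. i \<ge> N \<Longrightarrow> j \<ge> N \<Longrightarrow> sq_norm \<Omega> (\<lambda>x. s i x - s j x) < e\<^sup>2 / A"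
      using Cauchy by blast
    have "(LINT x|?M. norm (s i x - s j x)) < e" if "i \<ge> N" "j \<ge> N" for i j
    proof -
      have "(LINT x|?M. norm (s i x - s j x))\<^sup>2 \<le> sq_norm \<Omega> (\<lambda>x. s i x - s j x) * measure lebesgue \<Omega>"
        by (rule integral_norm_L2_bound[OF L2_diff[OF s s]])
      also have "\<dots> \<le> sq_norm \<Omega> (\<lambda>x. s i x - s j x) * A" by (intro mult_left_mono) (auto simp: A_def)
      also have "\<dots> < e\<^sup>2" using N[OF that] A by (simp add: field_simps)
      finally show ?thesis using e by (simp add: power2_less_imp_less)
    qed
    then show ?thesis by blast
  qed
  then obtain r where r: "strict_mono r" "AE x in ?M. Cauchy (\<lambda>i. s (r i) x)"
    using cauchy_L1_AE_cauchy_subseq[of ?M s] integrable_L2[OF s] by blast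
  define f where "f x = lim (\<lambda>i. s (r i) x)" for x
  have [measurable]: "f \<in> borel_measurable ?M" unfolding f_def by measurable
  have conv: "AE x in ?M. (\<lambda>i. s (r i) x) \<longlonglongrightarrow> f x"
    using r(2) by eventually_elim (simp add: f_def Cauchy_convergent_iff convergent_LIMSEQ_iff)
  have bound: "(\<integral>\<^sup>+x. ennreal ((norm (f x - s n x))\<^sup>2) \<partial>?M) \<le> ennreal e"
    if N: "\<And>i. i \<ge> N \<Longrightarrow> sq_norm \<Omega> (\<lambda>x. s i x - s n x) < e" for n N e
  proof -
    have "(\<integral>\<^sup>+x. ennreal ((norm (f x - s n x))\<^sup>2) \<partial>?M) =
        (\<integral>\<^sup>+x. liminf (\<lambda>i. ennreal ((norm (s (r i) x - s n x))\<^sup>2)) \<partial>?M)"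
    proof (rule nn_integral_cong_AE)
      show "AE x in ?M. ennreal ((norm (f x - s n x))\<^sup>2) = liminf (\<lambda>i. ennreal ((norm (s (r i) x - s n x))\<^sup>2))"
        using conv
      proof eventually_elim
        case (elim x)
        have "(\<lambda>i. ennreal ((norm (s (r i) x - s n x))\<^sup>2)) \<longlonglongrightarrow> ennreal ((norm (f x - s n x))\<^sup>2)"
          by (intro tendsto_ennrealI tendsto_intros elim)
        from lim_imp_Liminf[OF _ this] show ?case by simp
      qed
    qed
    also have "\<dots> \<le> liminf (\<lambda>i. \<integral>\<^sup>+x. ennreal ((norm (s (r i) x - s n x))\<^sup>2) \<partial>?M)"
      by (rule nn_integral_liminf) auto
    also have "\<dots> \<le> liminf (\<lambda>i. ennreal e)"
    proof (rule Liminf_mono, rule eventually_sequentiallyI)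
      fix i assume "N \<le> i"
      then have "N \<le> r i" using seq_suble[OF r(1), of i] by linarith
      then show "(\<integral>\<^sup>+x. ennreal ((norm (s (r i) x - s n x))\<^sup>2) \<partial>?M) \<le> ennreal e"
        using nn_integral_eq_integral[OF L2D(2)[OF L2_diff[OF s s]], of "r i" n] N[of "r i"]
        by (simp add: ennreal_leI)
    qed
    finally show ?thesis by (simp add: Liminf_const)
  qed
  have diff: "(\<lambda>x. f x - s n x) \<in> L2 \<Omega> \<and> sq_norm \<Omega> (\<lambda>x. f x - s n x) \<le> e"
    if N: "\<And>i. i \<ge> N \<Longrightarrow> sq_norm \<Omega> (\<lambda>x. s i x - s n x) < e" for n N e
  proof
    have "0 \<le> sq_norm \<Omega> (\<lambda>x. s N x - s n x)" by simp
    then have e: "0 < e" using N[OF order_refl] by linarith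
    have "integrable ?M (\<lambda>x. (norm (f x - s n x))\<^sup>2)"
      by (rule integrableI_bounded) (use le_less_trans[OF bound[OF N] ennreal_less_top] in auto)
    then show "(\<lambda>x. f x - s n x) \<in> L2 \<Omega>" by (simp add: L2_def)
    show "sq_norm \<Omega> (\<lambda>x. f x - s n x) \<le> e"
      using bound[OF N] nn_integral_eq_integral[OF L2D(2)[OF \<open>(\<lambda>x. f x - s n x) \<in> L2 \<Omega>\<close>]] e by simp
  qed
  have "f \<in> L2 \<Omega>"
  proof -
    obtain N where "\<And>i j. i \<ge> N \<Longrightarrow> j \<ge> N \<Longrightarrow> sq_norm \<Omega> (\<lambda>x. s i x - s j x) < 1"
      using Cauchy[of 1] by auto
    then have "(\<lambda>x. f x - s N x) \<in> L2 \<Omega>" using diff[of N N 1] by blast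
    from L2_combination(1)[OF this s[of N], of 1] show ?thesis by simp
  qed
  moreover have "(\<lambda>n. sq_norm \<Omega> (\<lambda>x. f x - s n x)) \<longlonglongrightarrow> 0"
  proof (rule LIMSEQ_I)
    fix e :: real assume "0 < e"
    then obtain N where N: "\<forall>i\<ge>N. \<forall>j\<ge>N. sq_norm \<Omega> (\<lambda>x. s i x - s j x) < e / 2"
      using Cauchy[OF half_gt_zero[OF \<open>0 < e\<close>]] by blast
    have "norm (sq_norm \<Omega> (\<lambda>x. f x - s n x) - 0) < e" if "n \<ge> N" for n
    proof -
      have "sq_norm \<Omega> (\<lambda>x. f x - s n x) \<le> e / 2"
        by (rule conjunct2[OF diff]) (use N that in blast)
      then show ?thesis using \<open>0 < e\<close> by simp
    qed
    then show "\<exists>N. \<forall>n\<ge>N. norm (sq_norm \<Omega> (\<lambda>x. f x - s n x) - 0) < e" by (intro exI allI impI)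
  qed
  ultimately have "L2_tendsto \<Omega> s f" using s by (simp add: L2_tendsto_def)
  then show ?thesis by (rule that)
qed

end

section \<open>Test functions\<close>


lemma C_k_combination:
  assumes "C_k k f" "C_k k g"
  shows "C_k k (\<lambda>x. f x + c * g x)"
  using assms
proof (induction k arbitrary: f g)
  case 0
  then show ?case by (auto intro!: continuous_intros)
next
  case (Suc k)
  have d: "f differentiable (at x)" "g differentiable (at x)" for x using Suc.prems by auto
  have fr: "frechet_derivative (\<lambda>x. f x + c * g x) (at x) = (\<lambda>h. frechet_derivative f (at x) h + c * frechet_derivative g (at x) h)" for x
    by (rule frechet_derivative_at[symmetric])
      (intro has_derivative_add has_derivative_mult_right d[unfolded frechet_derivative_works])
  show ?case
    using Suc.prems d by (auto simp: fr intro!: Suc.IH derivative_intros)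
qed

lemma grad_inner:
  assumes "f differentiable (at x)"
  shows "frechet_derivative f (at x) = (\<lambda>h. grad f x \<bullet> h)"
proof
  fix h
  interpret linear "frechet_derivative f (at x)" by (rule linear_frechet_derivative[OF assms])
  have "frechet_derivative f (at x) h = frechet_derivative f (at x) (\<Sum>b\<in>Basis. (h \<bullet> b) *\<^sub>R b)"
    by (simp add: euclidean_representation)
  also have "\<dots> = (\<Sum>b\<in>Basis. (h \<bullet> b) * frechet_derivative f (at x) b)"
    by (simp add: sum scale)
  also have "\<dots> = grad f x \<bullet> h"
    unfolding grad_def inner_sum_left by (intro sum.cong) (auto simp: inner_commute)
  finally show "frechet_derivative f (at x) h = grad f x \<bullet> h" .
qed

lemma gradI:
  assumes "(f has_derivative (\<lambda>h. v \<bullet> h)) (at x)"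
  shows "grad f x = v"
proof -
  have "frechet_derivative f (at x) = (\<lambda>h. v \<bullet> h)" using frechet_derivative_at[OF assms] by simp
  then show ?thesis
    by (simp add: grad_def euclidean_representation)
qed

text \<open>The link between smooth test functions and the class in which the geometric inequalities
  were proved. The gradient vanishes off the closed support because the function is zero on an open
  neighbourhood of such a point.\<close>

lemma test_function_C1:
  assumes "\<phi> \<in> test_functions \<Omega>"
  obtains K where "C1_supported K \<phi> (grad \<phi>)" "K \<subseteq> \<Omega>"
proof -
  define K where "K = closure {x. \<phi> x \<noteq> 0}"
  have sub: "K \<subseteq> \<Omega>" and K: "compact K" using assms by (auto simp: test_functions_def K_def)
  have "\<forall>k. C_k k \<phi>" using assms by (simp add: test_functions_def)
  then have "C_k (Suc 0) \<phi>" by (rule spec)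
  then have d: "\<phi> differentiable (at x)" and c: "b \<in> Basis \<Longrightarrow> continuous_on UNIV (\<lambda>x. frechet_derivative \<phi> (at x) b)" for x b
    by auto
  have der: "(\<phi> has_derivative (\<lambda>h. grad \<phi> x \<bullet> h)) (at x)" for x
    by (rule has_derivative_eq_rhs[OF iffD1[OF frechet_derivative_works d] grad_inner[OF d]])
  have cont: "continuous_on UNIV (grad \<phi>)"
    unfolding grad_def[abs_def] by (intro continuous_on_sum continuous_on_scaleR c continuous_on_const)
  have z: "\<phi> y = 0" if "y \<in> - K" for y
    using that subsetD[OF closure_subset, of y "{x. \<phi> x \<noteq> 0}"] unfolding K_def by blast
  have z': "grad \<phi> x = 0" if "x \<in> - K" for x
  proof (rule gradI, rule has_derivative_transform_within_open[where f = "\<lambda>_. 0" and s = "- K"])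
    show "((\<lambda>_. 0) has_derivative (\<lambda>h. 0 \<bullet> h)) (at x)" by simp
    show "open (- K)" unfolding K_def by (rule open_Compl[OF closed_closure])
    show "x \<in> - K" by fact
    show "0 = \<phi> y" if "y \<in> - K" for y using z[OF that] by (rule sym)
  qed
  have "C1_supported K \<phi> (grad \<phi>)"
    unfolding C1_supported_def by (intro conjI allI impI K der cont z z') simp_all
  then show ?thesis using sub by (rule that)
qed

lemma grad_combination:
  assumes "\<phi> \<in> test_functions \<Omega>" "\<psi> \<in> test_functions \<Omega>"
  shows "grad (\<lambda>x. \<phi> x + c * \<psi> x) = (\<lambda>x. grad \<phi> x + c *\<^sub>R grad \<psi> x)"
proof
  fix x
  have D: "(\<phi> has_derivative (\<lambda>h. grad \<phi> x \<bullet> h)) (at x)" if "\<phi> \<in> test_functions \<Omega>" for \<phi>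
    using test_function_C1[OF that] C1_supportedD(2) by metis
  show "grad (\<lambda>x. \<phi> x + c * \<psi> x) x = grad \<phi> x + c *\<^sub>R grad \<psi> x"
    by (rule gradI, rule has_derivative_eq_rhs[OF has_derivative_add[OF D[OF assms(1)] has_derivative_mult_right[OF D[OF assms(2)]]]])
      (simp add: fun_eq_iff inner_add_left)
qed

lemma test_functions_combination:
  assumes "\<phi> \<in> test_functions \<Omega>" "\<psi> \<in> test_functions \<Omega>"
  shows "(\<lambda>x. \<phi> x + c * \<psi> x) \<in> test_functions \<Omega>"
proof -
  have "closure {x. \<phi> x + c * \<psi> x \<noteq> 0} \<subseteq> closure ({x. \<phi> x \<noteq> 0} \<union> {x. \<psi> x \<noteq> 0})"
    by (rule closure_mono) auto
  then have sub: "closure {x. \<phi> x + c * \<psi> x \<noteq> 0} \<subseteq> closure {x. \<phi> x \<noteq> 0} \<union> closure {x. \<psi> x \<noteq> 0}"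
    by (simp add: closure_Un)
  have "compact (closure {x. \<phi> x \<noteq> 0} \<union> closure {x. \<psi> x \<noteq> 0})"
    using assms by (auto simp: test_functions_def)
  from compact_Int_closed[OF this closed_closure, of "{x. \<phi> x + c * \<psi> x \<noteq> 0}"] sub
  have "compact (closure {x. \<phi> x + c * \<psi> x \<noteq> 0})"
    by (simp only: Int_absorb1)
  then show ?thesis
    using assms sub C_k_combination unfolding test_functions_def by blast
qed

lemma zero_test_function: "(\<lambda>_. 0) \<in> test_functions \<Omega>"
proof -
  have "C_k k (\<lambda>_::'a. 0)" for k by (induction k) simp_all
  then show ?thesis by (simp add: test_functions_def)
qed

text \<open>The integral of \<open>f (t b + x) - f x\<close> vanishes by translation invariance, and
  this difference is \<open>t (f' x \<bullet> b)\<close> up to an error of size \<open>e t\<close>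
  supported in a fixed ball. No iterated integration in coordinates is involved.\<close>

lemma integral_gradient_zero:
  fixes b :: "'a::euclidean_space"
  assumes f: "C1_supported K f f'"
  shows "(LINT x|lborel. f' x \<bullet> b) = 0"
proof -
  note D = C1_supportedD[OF f]
  note [measurable] = D(7,8)
  obtain R where R: "\<forall>x\<in>K. norm x \<le> R"
    using compact_imp_bounded[OF D(1)] by (auto simp: bounded_iff)
  \<comment> \<open>Large enough that for \<open>0 < t \<le> 1\<close> both \<open>x\<close> and
    \<open>t b + x\<close> avoid \<open>K\<close> whenever \<open>x\<close> is outside.\<close>
  define S where "S = cball (0::'a) (R + norm b)"
  define V where "V = measure lborel S"
  have V: "0 \<le> V" by (simp add: V_def)
  have intf: "integrable lborel f" using D(1,4,6) by (intro C1_supported_integrable[of K])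
  have intg: "integrable lborel (\<lambda>x. f' x \<bullet> b)"
    using D(1,3,5) by (intro C1_supported_integrable[of K]) (auto intro!: continuous_intros)
  have bound: "\<bar>LINT x|lborel. f' x \<bullet> b\<bar> \<le> e * (norm b * V)" if e: "e > 0" for e
  proof -
    obtain \<delta> where \<delta>: "\<delta> > 0" "\<And>x y. norm (y - x) < \<delta> \<Longrightarrow> \<bar>f y - f x - f' x \<bullet> (y - x)\<bar> \<le> e * norm (y - x)"
      using C1_supported_uniform_expansion[OF f e] by blast
    define t where "t = min 1 (\<delta> / (norm b + 1)) / 2"
    have nb: "norm b + 1 > 0" by (simp add: add_nonneg_pos)
    have t: "0 < t" "t \<le> 1" using \<delta>(1) nb by (auto simp: t_def)
    have "t * (norm b + 1) \<le> \<delta> / (norm b + 1) / 2 * (norm b + 1)"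
      using nb unfolding t_def by (intro mult_right_mono divide_right_mono) auto
    also have "k > 0 \<Longrightarrow> \<delta> / k / 2 * k < \<delta>" for k using \<delta>(1) by simp
    from this[OF nb] have "\<delta> / (norm b + 1) / 2 * (norm b + 1) < \<delta>" .
    finally have tb: "t * norm b < \<delta>" using t by (simp add: distrib_left)
    have translate: "integrable lborel (\<lambda>x. f (t *\<^sub>R b + x))" "(LINT x|lborel. f (t *\<^sub>R b + x)) = (LINT x|lborel. f x)"
      using intf integrable_distr_eq[of "(+) (t *\<^sub>R b)" lborel borel f] integral_distr[of "(+) (t *\<^sub>R b)" lborel borel f]
      by (simp_all add: lborel_distr_plus)
    have "t * (LINT x|lborel. f' x \<bullet> b) = - (LINT x|lborel. f (t *\<^sub>R b + x) - f x - t * (f' x \<bullet> b))"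
      using translate intf intg by simp
    then have "\<bar>t * (LINT x|lborel. f' x \<bullet> b)\<bar> = \<bar>LINT x|lborel. f (t *\<^sub>R b + x) - f x - t * (f' x \<bullet> b)\<bar>"
      by (simp only: abs_minus_cancel)
    then have "t * \<bar>LINT x|lborel. f' x \<bullet> b\<bar> = \<bar>LINT x|lborel. f (t *\<^sub>R b + x) - f x - t * (f' x \<bullet> b)\<bar>"
      using t by (simp only: abs_mult abs_of_pos)
    also have "\<dots> \<le> (LINT x|lborel. (e * (t * norm b)) * indicator S x)"
    proof (rule integral_abs_bound_integral)
      show "integrable lborel (\<lambda>x. f (t *\<^sub>R b + x) - f x - t * (f' x \<bullet> b))"
        using translate intf intg by simp
      show "integrable lborel (\<lambda>x. (e * (t * norm b)) * indicator S x)"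
        unfolding S_def by (intro integrable_mult_right integrable_real_indicator emeasure_bounded_finite bounded_cball) simp
      fix x
      show "\<bar>f (t *\<^sub>R b + x) - f x - t * (f' x \<bullet> b)\<bar> \<le> (e * (t * norm b)) * indicator S x"
      proof (cases "x \<in> S")
        case True
        then show ?thesis using \<delta>(2)[of "t *\<^sub>R b + x" x] tb t by simp
      next
        case False
        then have x: "R + norm b < norm x" by (simp add: S_def)
        moreover have "norm x \<le> norm (t *\<^sub>R b + x) + t * norm b"
          using norm_triangle_ineq4[of "t *\<^sub>R b + x" "t *\<^sub>R b"] t by simp
        moreover have "t * norm b \<le> norm b" using t by (simp add: mult_left_le_one_le)
        ultimately have "R < norm (t *\<^sub>R b + x)" by linarith
        moreover have "R < norm x" using x norm_ge_zero[of b] by linarith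
        ultimately have "t *\<^sub>R b + x \<notin> K" "x \<notin> K" using R by (meson not_le)+
        then show ?thesis using D(4,5) e t False by simp
      qed
    qed
    also have "\<dots> = t * (e * (norm b * V))" by (simp add: V_def S_def)
    finally show ?thesis using t by simp
  qed
  have "\<bar>LINT x|lborel. f' x \<bullet> b\<bar> \<le> 0 + e" if "e > 0" for e
  proof -
    have c: "norm b * V + 1 > 0" using V by (simp add: add_nonneg_pos)
    then have "\<bar>LINT x|lborel. f' x \<bullet> b\<bar> \<le> e / (norm b * V + 1) * (norm b * V)"
      using that by (intro bound) simp
    also have "\<dots> \<le> e" using that c by (simp add: field_simps)
    finally show ?thesis by simp
  qed
  then have "\<bar>LINT x|lborel. f' x \<bullet> b\<bar> \<le> 0" by (rule field_le_epsilon)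
  then show ?thesis by simp
qed

lemma C1_supported_mult:
  assumes f: "C1_supported K f f'" and g: "C1_supported L g g'"
  shows "C1_supported K (\<lambda>x. f x * g x) (\<lambda>x. f x *\<^sub>R g' x + g x *\<^sub>R f' x)"
proof -
  note D = C1_supportedD[OF f] and E = C1_supportedD[OF g]
  have "((\<lambda>x. f x * g x) has_derivative (\<lambda>h. (f x *\<^sub>R g' x + g x *\<^sub>R f' x) \<bullet> h)) (at x)" for x
    by (rule has_derivative_eq_rhs[OF has_derivative_mult[OF D(2) E(2)]]) (simp add: fun_eq_iff inner_add_left)
  moreover have "continuous_on UNIV (\<lambda>x. f x *\<^sub>R g' x + g x *\<^sub>R f' x)"
    using D(3,6) E(3,6) by (intro continuous_intros)
  ultimately show ?thesis using D(1,4,5) unfolding C1_supported_def by simp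
qed

lemma integral_lebesgue_on_eq_lborel:
  fixes u :: "'a::euclidean_space \<Rightarrow> 'b::euclidean_space"
  assumes \<Omega>: "open \<Omega>" and [measurable]: "u \<in> borel_measurable borel" and "\<And>x. x \<notin> \<Omega> \<Longrightarrow> u x = 0"
  shows "(LINT x|lebesgue_on \<Omega>. u x) = (LINT x|lborel. u x)"
    and "integrable (lebesgue_on \<Omega>) u \<longleftrightarrow> integrable lborel u"
proof -
  have u: "(\<lambda>x. indicator \<Omega> x *\<^sub>R u x) = u" using assms(3) by (auto simp: indicator_def fun_eq_iff)
  have S: "\<Omega> \<inter> space lebesgue \<in> sets lebesgue" using \<Omega> by simp
  show "(LINT x|lebesgue_on \<Omega>. u x) = (LINT x|lborel. u x)"
    unfolding integral_restrict_space[OF S] u by (rule integral_completion) simp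
  show "integrable (lebesgue_on \<Omega>) u \<longleftrightarrow> integrable lborel u"
    unfolding integrable_restrict_space[OF S] u by (rule integrable_completion) simp
qed

lemma borel_measurable_lebesgue_on:
  "u \<in> borel_measurable borel \<Longrightarrow> u \<in> borel_measurable (lebesgue_on \<Omega>)"
  by (intro measurable_restrict_space1 measurable_completion) simp

lemma test_function_L2:
  assumes \<Omega>: "open \<Omega>" and \<phi>: "\<phi> \<in> test_functions \<Omega>"
  shows "\<phi> \<in> L2 \<Omega>" "grad \<phi> \<in> L2 \<Omega>"
    and "sq_norm \<Omega> \<phi> = (LINT x|lborel. (\<phi> x)\<^sup>2)" "sq_norm \<Omega> (grad \<phi>) = (LINT x|lborel. (norm (grad \<phi> x))\<^sup>2)"
    and "(LINT x|lebesgue_on \<Omega>. \<phi> x) = (LINT x|lborel. \<phi> x)"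
proof -
  obtain K where C: "C1_supported K \<phi> (grad \<phi>)" "K \<subseteq> \<Omega>" by (rule test_function_C1[OF \<phi>])
  note D = C1_supportedD[OF C(1)]
  note [measurable] = D(7,8)
  have out: "\<phi> x = 0" "grad \<phi> x = 0" if "x \<notin> \<Omega>" for x using that D(4,5) C(2) by blast+
  have int: "integrable lborel (\<lambda>x. (norm (\<phi> x))\<^sup>2)" "integrable lborel (\<lambda>x. (norm (grad \<phi> x))\<^sup>2)"
    using D(1,3-6) by (intro C1_supported_integrable[OF D(1)]; auto intro!: continuous_intros)+
  show "\<phi> \<in> L2 \<Omega>"
    using int(1) integral_lebesgue_on_eq_lborel(2)[OF \<Omega>, of "\<lambda>x. (norm (\<phi> x))\<^sup>2"] out D(7,8)
    by (simp add: L2_def borel_measurable_lebesgue_on)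
  show "grad \<phi> \<in> L2 \<Omega>"
    using int(2) integral_lebesgue_on_eq_lborel(2)[OF \<Omega>, of "\<lambda>x. (norm (grad \<phi> x))\<^sup>2"] out D(7,8)
    by (simp add: L2_def borel_measurable_lebesgue_on)
  show "sq_norm \<Omega> \<phi> = (LINT x|lborel. (\<phi> x)\<^sup>2)" "sq_norm \<Omega> (grad \<phi>) = (LINT x|lborel. (norm (grad \<phi> x))\<^sup>2)"
    "(LINT x|lebesgue_on \<Omega>. \<phi> x) = (LINT x|lborel. \<phi> x)"
    using out by (simp_all add: integral_lebesgue_on_eq_lborel(1)[OF \<Omega>])
qed

text \<open>The product rule makes the sum of the two integrands a directional derivative of a
  compactly supported function, whose integral is zero.\<close>

lemma test_function_parts:
  assumes \<Omega>: "open \<Omega>" and \<phi>: "\<phi> \<in> test_functions \<Omega>" and \<psi>: "\<psi> \<in> test_functions \<Omega>"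
  shows "(LINT x|lebesgue_on \<Omega>. \<phi> x * (grad \<psi> x \<bullet> b)) = - (LINT x|lebesgue_on \<Omega>. (grad \<phi> x \<bullet> b) * \<psi> x)"
proof -
  obtain K where C: "C1_supported K \<phi> (grad \<phi>)" "K \<subseteq> \<Omega>" by (rule test_function_C1[OF \<phi>])
  obtain L where C': "C1_supported L \<psi> (grad \<psi>)" "L \<subseteq> \<Omega>" by (rule test_function_C1[OF \<psi>])
  note D = C1_supportedD[OF C(1)] and D' = C1_supportedD[OF C'(1)]
  note [measurable] = D(7,8) D'(7,8)
  have out: "\<phi> x = 0" "grad \<phi> x = 0" if "x \<notin> \<Omega>" for x using that D(4,5) C(2) by blast+
  have int: "integrable lborel (\<lambda>x. \<phi> x * (grad \<psi> x \<bullet> b))" "integrable lborel (\<lambda>x. (grad \<phi> x \<bullet> b) * \<psi> x)"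
    using D(1,3-6) D'(3,6) by (intro C1_supported_integrable[OF D(1)]; auto intro!: continuous_intros)+
  have "(LINT x|lborel. \<phi> x * (grad \<psi> x \<bullet> b)) + (LINT x|lborel. (grad \<phi> x \<bullet> b) * \<psi> x) =
      (LINT x|lborel. (\<phi> x *\<^sub>R grad \<psi> x + \<psi> x *\<^sub>R grad \<phi> x) \<bullet> b)"
    using int by (simp add: inner_add_left mult.commute)
  also have "\<dots> = 0" by (rule integral_gradient_zero[OF C1_supported_mult[OF C(1) C'(1)]])
  finally show ?thesis
    using out by (simp add: integral_lebesgue_on_eq_lborel(1)[OF \<Omega>])
qed

section \<open>The torsion function\<close>


lemma L2_inner_const:
  assumes "g \<in> L2 \<Omega>"
  shows "(\<lambda>x. g x \<bullet> b) \<in> L2 \<Omega>"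
proof -
  note [measurable] = L2D(1)[OF assms]
  have "integrable (lebesgue_on \<Omega>) (\<lambda>x. (norm (g x))\<^sup>2 * (norm b)\<^sup>2)"
    using L2D(2)[OF assms] by simp
  then have "integrable (lebesgue_on \<Omega>) (\<lambda>x. (norm (g x \<bullet> b))\<^sup>2)"
  proof (rule Bochner_Integration.integrable_bound)
    have "(g x \<bullet> b)\<^sup>2 \<le> (norm (g x))\<^sup>2 * (norm b)\<^sup>2" for x
      using Cauchy_Schwarz_ineq[of "g x" b] by (simp add: power2_norm_eq_inner)
    then show "AE x in lebesgue_on \<Omega>. norm ((norm (g x \<bullet> b))\<^sup>2) \<le> norm ((norm (g x))\<^sup>2 * (norm b)\<^sup>2)"
      by simp
  qed measurable
  then show ?thesis unfolding L2_def by simp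
qed

lemma L2_scaleR_const:
  assumes "u \<in> L2 \<Omega>"
  shows "(\<lambda>x. u x *\<^sub>R b) \<in> L2 \<Omega>"
  using L2D[OF assms] by (simp add: L2_def power_mult_distrib)

lemma H10_approx:
  assumes \<Omega>: "open \<Omega>" and H: "H10 \<Omega> u g"
  obtains \<phi> where "\<And>n. \<phi> n \<in> test_functions \<Omega>" "L2_tendsto \<Omega> \<phi> u" "L2_tendsto \<Omega> (\<lambda>n. grad (\<phi> n)) g"
proof -
  obtain \<phi> where \<phi>: "\<And>n. \<phi> n \<in> test_functions \<Omega>" and
    lim: "(\<lambda>n. (LINT x|lebesgue_on \<Omega>. (u x - \<phi> n x)\<^sup>2) + sq_norm \<Omega> (\<lambda>x. g x - grad (\<phi> n) x)) \<longlonglongrightarrow> 0"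
    using H unfolding H10_def by blast
  have L: "u \<in> L2 \<Omega>" "g \<in> L2 \<Omega>" using H by (auto simp: H10_def H1_def)
  have "(\<lambda>n. sq_norm \<Omega> (\<lambda>x. u x - \<phi> n x)) \<longlonglongrightarrow> 0"
    by (rule tendsto_sandwich[OF _ _ tendsto_const lim]) (auto intro!: always_eventually)
  moreover have "(\<lambda>n. sq_norm \<Omega> (\<lambda>x. g x - grad (\<phi> n) x)) \<longlonglongrightarrow> 0"
    by (rule tendsto_sandwich[OF _ _ tendsto_const lim]) (auto intro!: always_eventually)
  ultimately show ?thesis
    using that[OF \<phi>] L test_function_L2(1,2)[OF \<Omega> \<phi>] by (simp add: L2_tendsto_def)
qed

text \<open>\<open>H10\<close> demands membership in \<open>H1\<close> besides approximability. The
  weak gradient identity is inherited from the approximating test functions, since both of its sides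
  are continuous in L2.\<close>

lemma H10_limit:
  assumes \<Omega>: "open \<Omega>" and \<phi>: "\<And>n. \<phi> n \<in> test_functions \<Omega>"
    and lim: "L2_tendsto \<Omega> \<phi> u" "L2_tendsto \<Omega> (\<lambda>n. grad (\<phi> n)) g"
  shows "H10 \<Omega> u g"
proof -
  have L: "u \<in> L2 \<Omega>" "g \<in> L2 \<Omega>" using lim by (auto simp: L2_tendsto_def)
  have parts: "(LINT x|lebesgue_on \<Omega>. u x * (grad \<psi> x \<bullet> b)) = - (LINT x|lebesgue_on \<Omega>. (g x \<bullet> b) * \<psi> x)"
    if \<psi>: "\<psi> \<in> test_functions \<Omega>" for \<psi> b
  proof (rule LIMSEQ_unique)
    show "(\<lambda>n. LINT x|lebesgue_on \<Omega>. \<phi> n x * (grad \<psi> x \<bullet> b)) \<longlonglongrightarrow> (LINT x|lebesgue_on \<Omega>. u x * (grad \<psi> x \<bullet> b))"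
      using tendsto_inner_L2[OF lim(1) L2_tendsto_const[OF L2_inner_const[OF test_function_L2(2)[OF \<Omega> \<psi>]], of b]] by simp
    have "(\<lambda>n. LINT x|lebesgue_on \<Omega>. (grad (\<phi> n) x \<bullet> b) * \<psi> x) \<longlonglongrightarrow> (LINT x|lebesgue_on \<Omega>. (g x \<bullet> b) * \<psi> x)"
      using tendsto_inner_L2[OF lim(2) L2_tendsto_const[OF L2_scaleR_const[OF test_function_L2(1)[OF \<Omega> \<psi>]], of b]]
      by (simp add: mult.commute)
    then show "(\<lambda>n. LINT x|lebesgue_on \<Omega>. \<phi> n x * (grad \<psi> x \<bullet> b)) \<longlonglongrightarrow> - (LINT x|lebesgue_on \<Omega>. (g x \<bullet> b) * \<psi> x)"
      unfolding test_function_parts[OF \<Omega> \<phi> \<psi>] by (rule tendsto_minus)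
  qed
  have "(\<lambda>n. (LINT x|lebesgue_on \<Omega>. (u x - \<phi> n x)\<^sup>2) + sq_norm \<Omega> (\<lambda>x. g x - grad (\<phi> n) x)) \<longlonglongrightarrow> 0"
    using tendsto_add[of "\<lambda>n. sq_norm \<Omega> (\<lambda>x. u x - \<phi> n x)" 0] lim by (simp add: L2_tendsto_def)
  then show ?thesis
    unfolding H10_def H1_def using L parts \<phi> by blast
qed

context
  fixes \<Omega> :: "'a::euclidean_space set"
  assumes \<Omega>: "open \<Omega>" "\<Omega> \<in> lmeasurable" "0 < measure lebesgue \<Omega>"
begin

lemma \<Omega>_lborel: "emeasure lborel \<Omega> < \<infinity>" "0 < measure lborel \<Omega>" "measure lborel \<Omega> = measure lebesgue \<Omega>"
  using \<Omega> by (auto simp: fmeasurable_def)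

lemma saint_venant_const_pos: "0 < saint_venant_const \<Omega>"
  unfolding saint_venant_const_def using \<Omega>_lborel content_ball_pos[of 1 "0::'a"]
  by (intro divide_pos_pos mult_pos_pos) (auto intro: add_pos_pos)

lemma Saint_Venant_test:
  assumes "\<phi> \<in> test_functions \<Omega>"
  shows "(LINT x|lebesgue_on \<Omega>. \<phi> x)\<^sup>2 \<le> saint_venant_const \<Omega> * sq_norm \<Omega> (grad \<phi>)"
proof -
  obtain K where "C1_supported K \<phi> (grad \<phi>)" "K \<subseteq> \<Omega>" by (rule test_function_C1[OF assms])
  from Saint_Venant_C1[OF \<Omega>(1) \<Omega>_lborel(1,2) this] show ?thesis
    by (simp only: test_function_L2[OF \<Omega>(1) assms])
qed

lemma Poincare_test:
  obtains c where "0 < c" "\<And>\<phi>. \<phi> \<in> test_functions \<Omega> \<Longrightarrow> sq_norm \<Omega> \<phi> \<le> c * sq_norm \<Omega> (grad \<phi>)"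
proof -
  obtain c where c: "0 < c" "\<And>K f f'. C1_supported K f f' \<Longrightarrow> K \<subseteq> \<Omega> \<Longrightarrow>
      (LINT x|lborel. (f x)\<^sup>2) \<le> c * (LINT x|lborel. (norm (f' x))\<^sup>2)"
    using Poincare_C1[OF \<Omega>(1) \<Omega>_lborel(1,2)] by metis
  have "sq_norm \<Omega> \<phi> \<le> c * sq_norm \<Omega> (grad \<phi>)" if \<phi>: "\<phi> \<in> test_functions \<Omega>" for \<phi>
  proof -
    obtain K where "C1_supported K \<phi> (grad \<phi>)" "K \<subseteq> \<Omega>" by (rule test_function_C1[OF \<phi>])
    from c(2)[OF this] show ?thesis
      by (simp only: test_function_L2(3,4)[OF \<Omega>(1) \<phi>])
  qed
  with c(1) show ?thesis by (rule that)
qed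

text \<open>The functional whose Euler-Lagrange equation is the weak form of
  \<open>-\<Delta> w = 1\<close>.\<close>

definition dirichlet_energy :: "('a \<Rightarrow> real) \<Rightarrow> real" where
  "dirichlet_energy \<phi> = sq_norm \<Omega> (grad \<phi>) / 2 - (LINT x|lebesgue_on \<Omega>. \<phi> x)"

lemma dirichlet_energy_line:
  assumes \<phi>: "\<phi> \<in> test_functions \<Omega>" and \<psi>: "\<psi> \<in> test_functions \<Omega>"
  shows "dirichlet_energy (\<lambda>x. \<phi> x + s * \<psi> x) = dirichlet_energy \<phi> +
    s * ((LINT x|lebesgue_on \<Omega>. grad \<phi> x \<bullet> grad \<psi> x) - (LINT x|lebesgue_on \<Omega>. \<psi> x)) + s\<^sup>2 / 2 * sq_norm \<Omega> (grad \<psi>)"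
proof -
  note L = test_function_L2[OF \<Omega>(1) \<phi>] and L' = test_function_L2[OF \<Omega>(1) \<psi>]
  have "(LINT x|lebesgue_on \<Omega>. \<phi> x + s * \<psi> x) = (LINT x|lebesgue_on \<Omega>. \<phi> x) + s * (LINT x|lebesgue_on \<Omega>. \<psi> x)"
    using integrable_L2[OF \<Omega>(2) L(1)] integrable_L2[OF \<Omega>(2) L'(1)] by simp
  moreover have "sq_norm \<Omega> (grad (\<lambda>x. \<phi> x + s * \<psi> x)) = sq_norm \<Omega> (grad \<phi>) +
      2 * s * (LINT x|lebesgue_on \<Omega>. grad \<phi> x \<bullet> grad \<psi> x) + s\<^sup>2 * sq_norm \<Omega> (grad \<psi>)"
    unfolding grad_combination[OF \<phi> \<psi>] by (rule L2_combination(2)[OF L(2) L'(2)])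
  ultimately show ?thesis by (simp add: dirichlet_energy_def field_simps)
qed

lemma dirichlet_energy_ge:
  assumes "\<phi> \<in> test_functions \<Omega>"
  shows "- saint_venant_const \<Omega> / 2 \<le> dirichlet_energy \<phi>"
proof -
  define c where "c = saint_venant_const \<Omega>"
  define E where "E = sq_norm \<Omega> (grad \<phi>)"
  have "0 \<le> E" by (simp add: E_def)
  have c: "0 < c" using saint_venant_const_pos by (simp add: c_def)
  have "(LINT x|lebesgue_on \<Omega>. \<phi> x)\<^sup>2 \<le> c * E" using Saint_Venant_test[OF assms] by (simp add: c_def E_def)
  \<comment> \<open>AM-GM, so that the linear term of the energy is at most half the gradient term
    plus \<open>c / 2\<close>.\<close>
  also have "\<dots> \<le> ((c + E) / 2)\<^sup>2"
    using zero_le_power2[of "c - E"] by (simp add: power2_eq_square field_simps)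
  finally have "(LINT x|lebesgue_on \<Omega>. \<phi> x) \<le> (c + E) / 2"
    by (rule power2_le_imp_le) (use c \<open>0 \<le> E\<close> in simp)
  then show ?thesis by (simp add: dirichlet_energy_def c_def E_def field_simps)
qed

text \<open>
  The torsion function is the limit of a minimizing sequence of the energy; the parallelogram
  identity makes the gradients a Cauchy sequence.
\<close>

lemma torsion_function_exists: "\<exists>w. is_torsion_function \<Omega> w"
proof -
  let ?T = "test_functions \<Omega>" and ?J = dirichlet_energy
  define m where "m = (INF \<phi>\<in>?T. ?J \<phi>)"
  have bdd: "bdd_below (?J ` ?T)"
    using dirichlet_energy_ge by (intro bdd_belowI2)
  have m: "m \<le> ?J \<phi>" if "\<phi> \<in> ?T" for \<phi> unfolding m_def using bdd that by (rule cINF_lower)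
  have ex: "\<exists>\<phi>. \<phi> \<in> ?T \<and> ?J \<phi> < m + inverse (real (Suc n))" for n
  proof -
    have "Inf (?J ` ?T) < m + inverse (real (Suc n))" by (simp add: m_def)
    then show ?thesis using cInf_lessD[of "?J ` ?T"] zero_test_function by blast
  qed
  obtain \<phi> where \<phi>: "\<And>n. \<phi> n \<in> ?T" and \<phi>J: "\<And>n. ?J (\<phi> n) < m + inverse (real (Suc n))"
    using choice[of "\<lambda>n \<phi>. \<phi> \<in> ?T \<and> ?J \<phi> < m + inverse (real (Suc n))"] ex by blast
  have diff: "(\<lambda>x. \<phi> i x - \<phi> j x) \<in> ?T" "grad (\<lambda>x. \<phi> i x - \<phi> j x) = (\<lambda>x. grad (\<phi> i) x - grad (\<phi> j) x)" for i j
    using test_functions_combination[OF \<phi> \<phi>, of i "-1" j] grad_combination[OF \<phi> \<phi>, of i "-1" j] by simp_all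
  have close: "sq_norm \<Omega> (\<lambda>x. grad (\<phi> i) x - grad (\<phi> j) x) \<le> 4 * (inverse (real (Suc i)) + inverse (real (Suc j)))" for i j
  proof -
    let ?d = "\<lambda>x. \<phi> i x - \<phi> j x"
    define a where "a s = ?J (\<lambda>x. \<phi> j x + s * ?d x)" for s
    define X where "X = (LINT x|lebesgue_on \<Omega>. grad (\<phi> j) x \<bullet> grad ?d x) - (LINT x|lebesgue_on \<Omega>. ?d x)"
    define Y where "Y = sq_norm \<Omega> (grad ?d)"
    have line: "a s = ?J (\<phi> j) + s * X + s\<^sup>2 / 2 * Y" for s
      unfolding a_def X_def Y_def by (rule dirichlet_energy_line[OF \<phi> diff(1)])
    \<comment> \<open>The energy is quadratic along the segment, and the mean of its endpoint values
      exceeds the midpoint value by \<open>Y / 8\<close>. As the midpoint cannot go below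
      \<open>m\<close>, \<open>Y\<close> is at most four times the sum of the two excesses.\<close>
    have "m \<le> a (1/2)" unfolding a_def by (intro m test_functions_combination \<phi> diff)
    moreover have "a 1 = ?J (\<phi> i)" by (simp add: a_def)
    ultimately have "Y \<le> 4 * (inverse (real (Suc i)) + inverse (real (Suc j)))"
      using line[of "1/2"] line[of 1] \<phi>J[of i] \<phi>J[of j] by (simp add: power2_eq_square)
    then show ?thesis by (simp only: Y_def diff(2))
  qed
  have Cauchy: "\<exists>N. \<forall>i\<ge>N. \<forall>j\<ge>N. sq_norm \<Omega> (\<lambda>x. grad (\<phi> i) x - grad (\<phi> j) x) < e" if e: "e > 0" for e
  proof -
    obtain N where N: "inverse (real (Suc N)) < e / 8" using reals_Archimedean[of "e/8"] e by auto
    have "sq_norm \<Omega> (\<lambda>x. grad (\<phi> i) x - grad (\<phi> j) x) < e" if "i \<ge> N" "j \<ge> N" for i j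
    proof -
      note close[of i j]
      also have "4 * (inverse (real (Suc i)) + inverse (real (Suc j))) \<le> 4 * (inverse (real (Suc N)) + inverse (real (Suc N)))"
        using that by (intro mult_left_mono add_mono le_imp_inverse_le) auto
      also have "\<dots> < e" using N by simp
      finally show ?thesis .
    qed
    then show ?thesis by blast
  qed
  obtain g where g: "L2_tendsto \<Omega> (\<lambda>n. grad (\<phi> n)) g"
    using L2_complete[OF \<Omega>(2) test_function_L2(2)[OF \<Omega>(1) \<phi>] Cauchy] .
  \<comment> \<open>The energy controls gradients only; Poincare turns their Cauchy property into
    one for the functions.\<close>
  obtain c where c: "0 < c" "\<And>\<phi>. \<phi> \<in> ?T \<Longrightarrow> sq_norm \<Omega> \<phi> \<le> c * sq_norm \<Omega> (grad \<phi>)"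
    by (rule Poincare_test) blast
  have Cauchy': "\<exists>N. \<forall>i\<ge>N. \<forall>j\<ge>N. sq_norm \<Omega> (\<lambda>x. \<phi> i x - \<phi> j x) < e" if "e > 0" for e
  proof -
    have "e / c > 0" using that c by simp
    then obtain N where N: "\<forall>i\<ge>N. \<forall>j\<ge>N. sq_norm \<Omega> (\<lambda>x. grad (\<phi> i) x - grad (\<phi> j) x) < e / c"
      using Cauchy by blast
    have "sq_norm \<Omega> (\<lambda>x. \<phi> i x - \<phi> j x) < e" if "i \<ge> N" "j \<ge> N" for i j
    proof -
      have "sq_norm \<Omega> (\<lambda>x. \<phi> i x - \<phi> j x) \<le> c * sq_norm \<Omega> (\<lambda>x. grad (\<phi> i) x - grad (\<phi> j) x)"
        using c(2)[OF diff(1)[of i j]] by (simp only: diff(2))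
      also have "\<dots> < c * (e / c)" using N that c(1) by (intro mult_strict_left_mono) auto
      finally show ?thesis using c(1) by simp
    qed
    then show ?thesis by blast
  qed
  obtain w where w: "L2_tendsto \<Omega> \<phi> w"
    using L2_complete[OF \<Omega>(2) test_function_L2(1)[OF \<Omega>(1) \<phi>] Cauchy'] .
  have H: "H10 \<Omega> w g" by (rule H10_limit[OF \<Omega>(1) \<phi> w g])
  have Jlim: "(\<lambda>n. ?J (\<phi> n)) \<longlonglongrightarrow> m"
  proof (rule tendsto_sandwich[of "\<lambda>_. m"])
    show "(\<lambda>n. m + inverse (real (Suc n))) \<longlonglongrightarrow> m"
      using tendsto_add[OF tendsto_const LIMSEQ_inverse_real_of_nat] by simp
    show "\<forall>\<^sub>F n in sequentially. ?J (\<phi> n) \<le> m + inverse (real (Suc n))"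
      by (intro always_eventually allI less_imp_le \<phi>J)
    show "\<forall>\<^sub>F n in sequentially. m \<le> ?J (\<phi> n)" by (intro always_eventually allI m \<phi>)
  qed simp
  \<comment> \<open>The limit \<open>w\<close> need not be a test function, so minimality cannot be
    applied to it directly. The sequence \<open>\<phi> n\<close> is perturbed instead, and the
    inequality \<open>m \<le> ...\<close> passes to the limit.\<close>
  have EL: "(LINT x|lebesgue_on \<Omega>. g x \<bullet> grad \<psi> x) = (LINT x|lebesgue_on \<Omega>. \<psi> x)" if \<psi>: "\<psi> \<in> ?T" for \<psi>
  proof -
    define Q where "Q = sq_norm \<Omega> (grad \<psi>)"
    define D where "D = (LINT x|lebesgue_on \<Omega>. g x \<bullet> grad \<psi> x) - (LINT x|lebesgue_on \<Omega>. \<psi> x)"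
    have Q: "0 \<le> Q" by (simp add: Q_def)
    have pos: "0 \<le> s * D + s\<^sup>2 / 2 * Q" for s
    proof -
      have inner: "(\<lambda>n. LINT x|lebesgue_on \<Omega>. grad (\<phi> n) x \<bullet> grad \<psi> x) \<longlonglongrightarrow> (LINT x|lebesgue_on \<Omega>. g x \<bullet> grad \<psi> x)"
        by (rule tendsto_inner_L2[OF g L2_tendsto_const[OF test_function_L2(2)[OF \<Omega>(1) \<psi>]]])
      have "(\<lambda>n. ?J (\<lambda>x. \<phi> n x + s * \<psi> x)) \<longlonglongrightarrow> m + s * D + s\<^sup>2 / 2 * Q"
        unfolding dirichlet_energy_line[OF \<phi> \<psi>] D_def Q_def
        by (intro tendsto_add tendsto_mult tendsto_diff tendsto_const Jlim inner)
      then have "m \<le> m + s * D + s\<^sup>2 / 2 * Q"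
        by (rule LIMSEQ_le_const) (auto intro!: m test_functions_combination \<phi> \<psi>)
      then show ?thesis by simp
    qed
    have "D = 0"
    proof (rule ccontr)
      assume "D \<noteq> 0"
      \<comment> \<open>The minimizer \<open>- D / Q\<close> of the parabola, with
        \<open>Q + 1\<close> as a guard against \<open>Q = 0\<close>; the value is still
        negative.\<close>
      define s where "s = - D / (Q + 1)"
      have "(- D / k) * D + (- D / k)\<^sup>2 / 2 * Q = - (D\<^sup>2 / k) * (1 - Q / (2 * k))" if "k \<noteq> 0" for k
        using that by (simp add: power2_eq_square field_simps)
      from this[of "Q + 1"] have "s * D + s\<^sup>2 / 2 * Q = - (D\<^sup>2 / (Q + 1)) * (1 - Q / (2 * (Q + 1)))"
        unfolding s_def using Q by simp
      moreover have "D\<^sup>2 / (Q + 1) > 0" using \<open>D \<noteq> 0\<close> Q by simp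
      moreover have "1 - Q / (2 * (Q + 1)) > 0" using Q by (simp add: field_simps)
      ultimately have "s * D + s\<^sup>2 / 2 * Q < 0" by (simp only: mult_neg_pos neg_less_0_iff_less)
      then show False using pos[of s] by simp
    qed
    then show ?thesis by (simp add: D_def)
  qed
  have "(LINT x|lebesgue_on \<Omega>. g x \<bullet> h x) = (LINT x|lebesgue_on \<Omega>. v x)" if vh: "H10 \<Omega> v h" for v h
  proof -
    obtain \<psi> where \<psi>: "\<And>n. \<psi> n \<in> ?T" "L2_tendsto \<Omega> \<psi> v" "L2_tendsto \<Omega> (\<lambda>n. grad (\<psi> n)) h"
      by (rule H10_approx[OF \<Omega>(1) vh]) blast
    have "g \<in> L2 \<Omega>" using g by (simp add: L2_tendsto_def)
    from tendsto_inner_L2[OF L2_tendsto_const[OF this] \<psi>(3)] tendsto_integral_L2[OF \<Omega>(2) \<psi>(2)]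
    show ?thesis unfolding EL[OF \<psi>(1)] by (rule LIMSEQ_unique)
  qed
  with H show ?thesis unfolding is_torsion_function_def by blast
qed

lemma torsional_rigidity_bounds:
  defines "T \<equiv> torsional_rigidity \<Omega>"
  shows "0 \<le> T" "T \<le> saint_venant_const \<Omega>" "dirichlet_eigenvalue \<Omega> * T \<le> measure lebesgue \<Omega>"
proof -
  define w where "w = torsion_function \<Omega>"
  have "is_torsion_function \<Omega> w"
    unfolding w_def torsion_function_def by (rule someI_ex[OF torsion_function_exists])
  then obtain g where g: "H10 \<Omega> w g"
    and weak: "\<And>v h. H10 \<Omega> v h \<Longrightarrow> (LINT x|lebesgue_on \<Omega>. g x \<bullet> h x) = (LINT x|lebesgue_on \<Omega>. v x)"
    unfolding is_torsion_function_def by blast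
  have L: "w \<in> L2 \<Omega>" using g by (simp add: H10_def H1_def)
  have Tw: "T = (LINT x|lebesgue_on \<Omega>. w x)" by (simp add: T_def torsional_rigidity_def w_def)
  have T: "T = sq_norm \<Omega> g" using weak[OF g] Tw by (simp add: power2_norm_eq_inner)
  show T0: "0 \<le> T" by (simp add: T)
  \<comment> \<open>Saint-Venant is available for test functions only; both of its sides converge
    along this sequence and give a quadratic inequality for \<open>T\<close>.\<close>
  obtain \<phi> where \<phi>: "\<And>n. \<phi> n \<in> test_functions \<Omega>" "L2_tendsto \<Omega> \<phi> w" "L2_tendsto \<Omega> (\<lambda>n. grad (\<phi> n)) g"
    by (rule H10_approx[OF \<Omega>(1) g]) blast
  have "T\<^sup>2 \<le> saint_venant_const \<Omega> * T"
  proof (rule LIMSEQ_le)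
    show "(\<lambda>n. (LINT x|lebesgue_on \<Omega>. \<phi> n x)\<^sup>2) \<longlonglongrightarrow> T\<^sup>2"
      unfolding Tw by (intro tendsto_power tendsto_integral_L2 \<Omega> \<phi>)
    show "(\<lambda>n. saint_venant_const \<Omega> * sq_norm \<Omega> (grad (\<phi> n))) \<longlonglongrightarrow> saint_venant_const \<Omega> * T"
      unfolding T by (intro tendsto_mult_left tendsto_sq_norm_L2 \<phi>)
    show "\<exists>N. \<forall>n\<ge>N. (LINT x|lebesgue_on \<Omega>. \<phi> n x)\<^sup>2 \<le> saint_venant_const \<Omega> * sq_norm \<Omega> (grad (\<phi> n))"
      using Saint_Venant_test[OF \<phi>(1)] by blast
  qed
  then show "T \<le> saint_venant_const \<Omega>"
    using T0 saint_venant_const_pos by (cases "T = 0") (auto simp: power2_eq_square)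
  have CS: "T\<^sup>2 \<le> sq_norm \<Omega> w * measure lebesgue \<Omega>"
    using Cauchy_Schwarz_L2[OF L L2_const[OF \<Omega>(2), of "1::real"]]
    unfolding measure_lebesgue_on_space[OF \<Omega>(2)] Tw by simp
  show "dirichlet_eigenvalue \<Omega> * T \<le> measure lebesgue \<Omega>"
  proof (cases "T = 0")
    case False
    then have "T > 0" using T0 by simp
    then have "0 < sq_norm \<Omega> w * measure lebesgue \<Omega>" using CS by (smt (verit) zero_less_power)
    then have N: "0 < sq_norm \<Omega> w" using \<Omega>(3) by (simp add: zero_less_mult_iff)
    have "\<not> (AE x in lebesgue_on \<Omega>. w x = 0)"
    proof
      assume "AE x in lebesgue_on \<Omega>. w x = 0"
      then have "T = 0" unfolding Tw by (rule integral_eq_zero_AE)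
      then show False using False by simp
    qed
    \<comment> \<open>Rayleigh quotients are nonnegative, and this lower bound makes the real
      \<open>Inf\<close> at most each of them, in particular the one of \<open>w\<close>.\<close>
    with g have "dirichlet_eigenvalue \<Omega> \<le> T / (LINT x|lebesgue_on \<Omega>. (w x)\<^sup>2)"
      unfolding dirichlet_eigenvalue_def T
      by (intro cInf_lower bdd_belowI[of _ 0]) (auto intro!: divide_nonneg_nonneg)
    then have "dirichlet_eigenvalue \<Omega> * T \<le> T / sq_norm \<Omega> w * T"
      using T0 by (intro mult_right_mono) auto
    also have "\<dots> \<le> measure lebesgue \<Omega>"
      using CS N by (simp add: power2_eq_square field_simps)
    finally show ?thesis .
  qed (use \<Omega>(3) in simp)
qed

lemma F_le:
  assumes q: "q > 1"
  shows "F q \<Omega> \<le> (1 / (real DIM('a) * (real DIM('a) + 2) * measure lebesgue (ball (0::'a) 1) powr (2 / real DIM('a)))) powr (q - 1)"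
    (is "_ \<le> ?k powr (q - 1)")
proof -
  define T where "T = torsional_rigidity \<Omega>"
  define A where "A = measure lebesgue \<Omega>"
  define d where "d = real DIM('a)"
  define k where "k = ?k"
  have d: "d > 0" by (simp add: d_def)
  have A: "A > 0" using \<Omega> by (simp add: A_def)
  note B = torsional_rigidity_bounds[folded T_def A_def]
  have "measure lebesgue (ball (0::'a) 1) > 0" using content_ball_pos[of 1 "0::'a"] by simp
  then have k: "k > 0" unfolding k_def by (intro divide_pos_pos mult_pos_pos) auto
  have c: "saint_venant_const \<Omega> = A powr ((d + 2) / d) * k"
    unfolding saint_venant_const_def k_def A_def d_def \<Omega>_lborel(3) by (simp add: algebra_simps)
  have "F q \<Omega> = dirichlet_eigenvalue \<Omega> * T powr q / A powr ((d * q + 2 * q - 2) / d)"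
    by (simp add: F_def T_def A_def d_def)
  also have "\<dots> \<le> k powr (q - 1)"
  proof (cases "T = 0")
    case True
    then show ?thesis by simp
  next
    case False
    then have T: "T > 0" using B(1) by simp
    have "T powr q = T * T powr (q - 1)" using T by (simp add: powr_diff)
    then have "dirichlet_eigenvalue \<Omega> * T powr q = (dirichlet_eigenvalue \<Omega> * T) * T powr (q - 1)" by simp
    also have "\<dots> \<le> A * T powr (q - 1)" using B(3) by (intro mult_right_mono) auto
    \<comment> \<open>The hypothesis \<open>q > 1\<close> enters here: the power
      \<open>q - 1\<close> must be monotone to transport the Saint-Venant bound.\<close>
    also have "\<dots> \<le> A * (A powr ((d + 2) / d) * k) powr (q - 1)"
      using B(2) T q A unfolding c by (intro mult_left_mono powr_mono2) auto
    also have "\<dots> = A powr 1 * A powr ((d + 2) / d * (q - 1)) * k powr (q - 1)"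
      using A k by (simp add: powr_mult powr_powr)
    also have "\<dots> = A powr ((d * q + 2 * q - 2) / d) * k powr (q - 1)"
    proof -
      have "1 + (d + 2) / d * (q - 1) = (d * q + 2 * q - 2) / d" using d by (simp add: field_simps)
      then show ?thesis by (simp only: powr_add[symmetric])
    qed
    finally show ?thesis using A by (simp add: divide_le_eq mult.commute)
  qed
  finally show ?thesis by (simp only: k_def)
qed

end

theorem proposition3p4:
  fixes q :: real
  assumes "q > 1"
  shows "(SUP \<Omega> \<in> {\<Omega> :: 'a::euclidean_space set.
                   open \<Omega> \<and> 0 < emeasure lebesgue \<Omega> \<and> emeasure lebesgue \<Omega> < \<infinity>}.
            ereal (F q \<Omega>))
         \<le> ereal ((1 / (real DIM('a) * (real DIM('a) + 2) *
                      measure lebesgue (ball (0::'a) 1) powr (2 / real DIM('a)))) powr (q - 1))"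
proof (rule SUP_least)
  fix \<Omega> :: "'a set"
  assume "\<Omega> \<in> {\<Omega>. open \<Omega> \<and> 0 < emeasure lebesgue \<Omega> \<and> emeasure lebesgue \<Omega> < \<infinity>}"
  then have \<Omega>: "open \<Omega>" "0 < emeasure lebesgue \<Omega>" "emeasure lebesgue \<Omega> < \<infinity>" by auto
  then have "\<Omega> \<in> lmeasurable" by (simp add: fmeasurable_def)
  moreover have "0 < measure lebesgue \<Omega>"
    using \<Omega>(2,3) by (simp add: measure_def enn2real_positive_iff)
  ultimately show "ereal (F q \<Omega>) \<le> ereal ((1 / (real DIM('a) * (real DIM('a) + 2) *
                      measure lebesgue (ball (0::'a) 1) powr (2 / real DIM('a)))) powr (q - 1))"
    using F_le[OF \<Omega>(1) _ _ assms] by simp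
qed

end
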